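(* Let $\{\mathcal H,\Gamma_0,\Gamma_1\}$ be a unitary boundary triple for $A^*$ with $\gamma$-field $\gamma(\cdot)$ and Weyl function $M(\cdot)$, and assume $A_0=\ker\Gamma_0$ is essentially selfadjoint. Then: (1) there exists a bounded operator $G$ in $\mathcal H$ with $\ker G=\{0\}$ and $\operatorname{ran}G=\operatorname{dom}\overline{\gamma(\lambda)}$ for all $\lambda\in\mathbb C\setminus\mathbb R$ such that the closure $\widetilde\Gamma$ of $\{\hat f\mapsto\{G^{-1}\Gamma_0\hat f,\ G^*\Gamma_1\hat f\}\}$ (defined for $\hat f\in\operatorname{dom}\Gamma$ with $\Gamma_0\hat f\in\operatorname{ran}G$) is an AB-generalized boundary pair $\{\mathcal H,\widetilde\Gamma\}$ for $A^*$; (2) the Weyl family $\widetilde M$ of $\widetilde\Gamma$ is domain invariant and $\widetilde M(\lambda)=E+M_0(\lambda)$, where $E$ is a closed densely defined symmetric operator in $\mathcal H$ and $M_0(\lambda)$ is a bounded operator on $\operatorname{dom}E$ with $\overline{M_0(\cdot)}\in\mathcal R[\mathcal H]$; (3) $\overline{G^*M(\cdot)G}$ is the Weyl family of a closed AB-generalized boundary pair for $A^*$, and $\overline{G^*M(\lambda)G}=E_0+M_0(\lambda)\subset\widetilde M(\lambda)$, $\lambda\in\mathbb C\setminus\mathbb R$, where $E_0\subset E$ is a closed densely defined symmetric restriction of $E$.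
   Context: $A$ closed symmetric relation in $\mathfrak H$, $\mathcal H$ Hilbert space. Unitary boundary triple: a linear operator $\Gamma=\{\Gamma_0,\Gamma_1\}$ from $\mathfrak H^2$ to $\mathcal H^2$ with $\operatorname{dom}\Gamma\subset A^*$ dense in $A^*$ and $\Gamma^{-1}=\Gamma^{[*]}$, where $\Gamma^{[*]}=\{\{\{k,k'\},\{g,g'\}\}:(f',g)-(f,g')=(h',k)-(h,k')\ \forall\{\{f,f'\},\{h,h'\}\}\in\Gamma\}$. Weyl function and $\gamma$-field: $M(\lambda)\Gamma_0\hat f_\lambda=\Gamma_1\hat f_\lambda$, $\gamma(\lambda)\Gamma_0\hat f_\lambda=f_\lambda$ for $\hat f_\lambda=\{f_\lambda,\lambda f_\lambda\}\in\operatorname{dom}\Gamma$. An AB-generalized boundary pair for $A^*$ is a linear relation $\Gamma:\mathfrak H^2\to\mathcal H^2$ with domain in $A^*$ dense in $A^*$ satisfying Green's identity $(f',g)-(f,g')=(h',k)-(h,k')$ on $\Gamma$, with $\operatorname{ran}\Gamma_0$ dense and $\ker\Gamma_0$ selfadjoint ($\Gamma_0=\{\{\hat f,h\}:\{\hat f,\{h,h'\}\}\in\Gamma\}$); its Weyl family is $\{\hat h:\{\{f,\lambda f\},\hat h\}\in\Gamma\}$. Domain invariant: $\operatorname{dom}\widetilde M(\lambda)$ independent of $\lambda\in\mathbb C\setminus\mathbb R$. $\mathcal R[\mathcal H]$: holomorphic $\mathcal B(\mathcal H)$-valued $F$ on $\mathbb C\setminus\mathbb R$, $F(\bar\lambda)=F(\lambda)^*$,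 $\operatorname{Im}F(\lambda)\ge0$ on $\mathbb C_+$. *)

theory Defs
  imports "HOL-Analysis.Analysis"
begin

class complex_inner = real_normed_vector +
  fixes scaleC :: "complex \<Rightarrow> 'a \<Rightarrow> 'a" (infixr "*\<^sub>C" 75)
    and cinner :: "'a \<Rightarrow> 'a \<Rightarrow> complex"
  assumes scaleC_add_right: "scaleC a (x + y) = scaleC a x + scaleC a y"
    and scaleC_add_left: "scaleC (a + b) x = scaleC a x + scaleC b x"
    and scaleC_scaleC: "scaleC a (scaleC b x) = scaleC (a * b) x"
    and scaleC_one: "scaleC 1 x = x"
    and scaleR_scaleC: "scaleR r x = scaleC (complex_of_real r) x"
    and cinner_add_left: "cinner (x + y) z = cinner x z + cinner y z"
    and cinner_scaleC_left: "cinner (scaleC a x) y = a * cinner x y"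
    and cinner_commute: "cinner y x = cnj (cinner x y)"
    and cinner_ge_zero: "0 \<le> Re (cinner x x)"
    and cinner_eq_zero: "cinner x x = 0 \<Longrightarrow> x = 0"
    and norm_cinner: "norm x = sqrt (Re (cinner x x))"

class chilbert = complex_inner + complete_space

definition bclin :: "('a::complex_inner \<Rightarrow> 'b::complex_inner) \<Rightarrow> bool" where
  "bclin T \<longleftrightarrow> bounded_linear T \<and> (\<forall>c x. T (c *\<^sub>C x) = c *\<^sub>C T x)"

definition is_adj :: "('a::complex_inner \<Rightarrow> 'b::complex_inner) \<Rightarrow> ('b \<Rightarrow> 'a) \<Rightarrow> bool" where
  "is_adj T S \<longleftrightarrow> (\<forall>x y. cinner (T x) y = cinner x (S y))"

definition clin_rel :: "('a::complex_inner \<times> 'b::complex_inner) set \<Rightarrow> bool" where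
  "clin_rel L \<longleftrightarrow> (0, 0) \<in> L \<and> (\<forall>p\<in>L. \<forall>q\<in>L. p + q \<in> L)
     \<and> (\<forall>c x y. (x, y) \<in> L \<longrightarrow> (c *\<^sub>C x, c *\<^sub>C y) \<in> L)"

definition clin_brel :: "(('a::complex_inner \<times> 'a) \<times> ('b::complex_inner \<times> 'b)) set \<Rightarrow> bool" where
  "clin_brel G \<longleftrightarrow> ((0, 0), (0, 0)) \<in> G \<and> (\<forall>p\<in>G. \<forall>q\<in>G. p + q \<in> G)
     \<and> (\<forall>c f f' h h'. ((f, f'), (h, h')) \<in> G \<longrightarrow> ((c *\<^sub>C f, c *\<^sub>C f'), (c *\<^sub>C h, c *\<^sub>C h')) \<in> G)"

definition rdom :: "('a \<times> 'b) set \<Rightarrow> 'a set" where "rdom L = fst ` L"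
definition rran :: "('a \<times> 'b) set \<Rightarrow> 'b set" where "rran L = snd ` L"
definition rker :: "('a \<times> 'b::zero) set \<Rightarrow> 'a set" where "rker L = {x. (x, 0) \<in> L}"
definition rmul :: "('a::zero \<times> 'b) set \<Rightarrow> 'b set" where "rmul L = {y. (0, y) \<in> L}"

definition radj :: "('a::complex_inner \<times> 'a) set \<Rightarrow> ('a \<times> 'a) set" where
  "radj L = {(h, h'). \<forall>(f, f')\<in>L. cinner f' h = cinner f h'}"

definition rsymmetric :: "('a::complex_inner \<times> 'a) set \<Rightarrow> bool" where
  "rsymmetric L \<longleftrightarrow> clin_rel L \<and> L \<subseteq> radj L"

definition rselfadjoint :: "('a::complex_inner \<times> 'a) set \<Rightarrow> bool" where
  "rselfadjoint L \<longleftrightarrow> L = radj L"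

definition roperator :: "('a::complex_inner \<times> 'b::complex_inner) set \<Rightarrow> bool" where
  "roperator L \<longleftrightarrow> clin_rel L \<and> rmul L = {0}"

definition cdd_sym_op :: "('a::complex_inner \<times> 'a) set \<Rightarrow> bool" where
  "cdd_sym_op E \<longleftrightarrow> roperator E \<and> closed E \<and> closure (rdom E) = UNIV \<and> rsymmetric E"

definition bmul :: "(('a::zero \<times> 'a) \<times> ('b \<times> 'b)) set \<Rightarrow> ('b \<times> 'b) set" where
  "bmul G = {y. ((0, 0), y) \<in> G}"

definition gamma_adj :: "(('a::complex_inner \<times> 'a) \<times> ('b::complex_inner \<times> 'b)) set
    \<Rightarrow> (('b \<times> 'b) \<times> ('a \<times> 'a)) set" where
  "gamma_adj G = {((k, k'), (g, g')). \<forall>((f, f'), (h, h'))\<in>G.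
      cinner f' g - cinner f g' = cinner h' k - cinner h k'}"

definition Gamma0 :: "(('a \<times> 'a) \<times> ('b \<times> 'b)) set \<Rightarrow> (('a \<times> 'a) \<times> 'b) set" where
  "Gamma0 G = {(fh, h). \<exists>h'. (fh, (h, h')) \<in> G}"

definition unitary_bt :: "('a::complex_inner \<times> 'a) set \<Rightarrow> (('a \<times> 'a) \<times> ('b::complex_inner \<times> 'b)) set \<Rightarrow> bool" where
  "unitary_bt A G \<longleftrightarrow> clin_brel G \<and> bmul G = {(0, 0)}
     \<and> rdom G \<subseteq> radj A \<and> radj A \<subseteq> closure (rdom G)
     \<and> converse G = gamma_adj G"

definition green :: "(('a::complex_inner \<times> 'a) \<times> ('b::complex_inner \<times> 'b)) set \<Rightarrow> bool" where
  "green G \<longleftrightarrow> (\<forall>((f, f'), (h, h'))\<in>G. \<forall>((g, g'), (k, k'))\<in>G.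
      cinner f' g - cinner f g' = cinner h' k - cinner h k')"

definition AB_pair :: "('a::complex_inner \<times> 'a) set \<Rightarrow> (('a \<times> 'a) \<times> ('b::complex_inner \<times> 'b)) set \<Rightarrow> bool" where
  "AB_pair A G \<longleftrightarrow> clin_brel G \<and> rdom G \<subseteq> radj A \<and> radj A \<subseteq> closure (rdom G)
     \<and> green G \<and> closure (rran (Gamma0 G)) = UNIV \<and> rselfadjoint (rker (Gamma0 G))"

definition weyl :: "(('a::complex_inner \<times> 'a) \<times> ('b \<times> 'b)) set \<Rightarrow> complex \<Rightarrow> ('b \<times> 'b) set" where
  "weyl G z = {(h, h'). \<exists>f. ((f, z *\<^sub>C f), (h, h')) \<in> G}"

definition gamma_field :: "(('a::complex_inner \<times> 'a) \<times> ('b \<times> 'b)) set \<Rightarrow> complex \<Rightarrow> ('b \<times> 'a) set" where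
  "gamma_field G z = {(h, f). \<exists>h'. ((f, z *\<^sub>C f), (h, h')) \<in> G}"

definition domain_invariant :: "(complex \<Rightarrow> ('b \<times> 'b) set) \<Rightarrow> bool" where
  "domain_invariant M \<longleftrightarrow> (\<forall>z w. Im z \<noteq> 0 \<longrightarrow> Im w \<noteq> 0 \<longrightarrow> rdom (M z) = rdom (M w))"

definition op_holomorphic :: "(complex \<Rightarrow> 'b::complex_inner \<Rightarrow> 'b) \<Rightarrow> complex set \<Rightarrow> bool" where
  "op_holomorphic F S \<longleftrightarrow> (\<forall>z\<in>S. \<exists>D. bclin D \<and>
     ((\<lambda>w. onorm (\<lambda>x. F w x - F z x - (w - z) *\<^sub>C D x) / cmod (w - z)) \<longlongrightarrow> 0) (at z))"

definition nevanlinna :: "(complex \<Rightarrow> 'b::complex_inner \<Rightarrow> 'b) \<Rightarrow> bool" where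
  "nevanlinna F \<longleftrightarrow> (\<forall>z. Im z \<noteq> 0 \<longrightarrow> bclin (F z))
     \<and> op_holomorphic F {z. Im z \<noteq> 0}
     \<and> (\<forall>z. Im z \<noteq> 0 \<longrightarrow> is_adj (F z) (F (cnj z)))
     \<and> (\<forall>z. Im z > 0 \<longrightarrow> (\<forall>x. 0 \<le> Im (cinner (F z x) x)))"

definition bounded_on :: "'b::complex_inner set \<Rightarrow> ('b \<Rightarrow> 'b) \<Rightarrow> bool" where
  "bounded_on D T \<longleftrightarrow> (\<forall>x\<in>D. \<forall>y\<in>D. T (x + y) = T x + T y)
     \<and> (\<forall>c. \<forall>x\<in>D. T (c *\<^sub>C x) = c *\<^sub>C T x)
     \<and> (\<exists>C. \<forall>x\<in>D. norm (T x) \<le> C * norm x)"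

definition graph_on :: "'b set \<Rightarrow> ('b \<Rightarrow> 'b) \<Rightarrow> ('b \<times> 'b) set" where
  "graph_on D T = {(x, T x) | x. x \<in> D}"

definition op_plus :: "('b::complex_inner \<times> 'b) set \<Rightarrow> ('b \<Rightarrow> 'b) \<Rightarrow> ('b \<times> 'b) set" where
  "op_plus E T = {(x, y + T x) | x y. (x, y) \<in> E}"

definition sandwich :: "('b \<Rightarrow> 'b) \<Rightarrow> ('b \<times> 'b) set \<Rightarrow> ('b \<Rightarrow> 'b) \<Rightarrow> ('b \<times> 'b) set" where
  "sandwich Gs M G = {(x, Gs y) | x y. (G x, y) \<in> M}"

text \<open>\<open>{f\<^sup>^ \<mapsto> {G\<^sup>-\<^sup>1 \<Gamma>\<^sub>0 f\<^sup>^, G\<^sup>* \<Gamma>\<^sub>1 f\<^sup>^}}\<close> on \<open>{f\<^sup>^ \<in> dom \<Gamma> : \<Gamma>\<^sub>0 f\<^sup>^ \<in> ran G}\<close>.\<close>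
definition transformed :: "(('a \<times> 'a) \<times> ('b \<times> 'b)) set \<Rightarrow> ('b \<Rightarrow> 'b) \<Rightarrow> ('b \<Rightarrow> 'b)
    \<Rightarrow> (('a \<times> 'a) \<times> ('b \<times> 'b)) set" where
  "transformed G0 G Gs = {(fh, (x, Gs h')) | fh x h'. (fh, (G x, h')) \<in> G0}"

end

theory Submission
  imports Defs
begin

text \<open>
  Everything rests on two facts about a unitary triple \<open>\<Gamma>\<close> whose main transform is selfadjoint. First,
  \<open>\<gamma>(z)\<^sup>*\<close> is exactly \<open>\<Gamma>\<^sub>1 (A\<^sub>0 - cnj z)\<^sup>-\<^sup>1\<close>. Hence \<open>(h, f)\<close> lies in the closure of \<open>\<gamma>(z)\<close> iff
  \<open>((f, z f), h)\<close> lies in a closed relation \<open>W\<close> which does not depend on \<open>z\<close> and contains the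
  selfadjoint closure \<open>B\<close> of \<open>A\<^sub>0\<close> (paired with 0); adding elements of \<open>B\<close> moves \<open>z\<close>, so the domain of
  the closure is independent of \<open>z\<close>. Polar decomposition of that closure at \<open>z = \<i>\<close> writes its graph as
  \<open>{(G x, K x)}\<close> with \<open>G\<close> bounded, selfadjoint and injective and \<open>\<parallel>G x\<parallel>\<^sup>2 + \<parallel>K x\<parallel>\<^sup>2 = \<parallel>x\<parallel>\<^sup>2\<close>.
  Then \<open>F(z) = K\<^sup>* (z + (z\<^sup>2 + 1) (B - z)\<^sup>-\<^sup>1) K\<close> and \<open>E\<close> is the Weyl operator at \<open>\<i>\<close> minus \<open>\<i> K\<^sup>* K\<close>.

  Second, \<open>M(z) + z\<close> is surjective. So \<open>G M(z) G + z G\<^sup>2\<close> has dense range, while the Weyl operator of the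
  closed transformed pair plus \<open>z G\<^sup>2\<close> is bounded below; therefore this Weyl operator is already the
  closure of \<open>G M(z) G\<close>, and \<open>E\<^sub>0 = E\<close> works in part (3).
\<close>

section \<open>Complex inner product spaces\<close>

lemma scaleC_zero_right [simp]: "c *\<^sub>C (0::'a::complex_inner) = 0"
  using scaleC_add_right[of c "0::'a" 0] by simp

lemma scaleC_zero_left [simp]: "0 *\<^sub>C (x::'a::complex_inner) = 0"
  using scaleC_add_left[of 0 0 x] by simp

lemma scaleC_one' [simp]: "1 *\<^sub>C (x::'a::complex_inner) = x"
  by (rule scaleC_one)

lemma scaleC_minus_left [simp]: "(- a) *\<^sub>C (x::'a::complex_inner) = - (a *\<^sub>C x)"
  using scaleC_add_left[of "-a" a x] by (simp add: eq_neg_iff_add_eq_0)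

lemma scaleC_minus_right [simp]: "a *\<^sub>C (- x::'a::complex_inner) = - (a *\<^sub>C x)"
  using scaleC_add_right[of a "-x" x] by (simp add: eq_neg_iff_add_eq_0)

lemma scaleC_diff_left: "(a - b) *\<^sub>C (x::'a::complex_inner) = a *\<^sub>C x - b *\<^sub>C x"
  using scaleC_add_left[of a "-b" x] by simp

lemma scaleC_diff_right: "a *\<^sub>C (x - y::'a::complex_inner) = a *\<^sub>C x - a *\<^sub>C y"
  using scaleC_add_right[of a x "-y"] by simp

lemmas scaleC_algebra = scaleC_add_left scaleC_add_right scaleC_diff_left scaleC_diff_right scaleC_scaleC

lemma cinner_add_right: "cinner x (y + z::'a::complex_inner) = cinner x y + cinner x z"
  by (metis cinner_add_left cinner_commute complex_cnj_add)

lemma cinner_scaleC_right: "cinner x (a *\<^sub>C y::'a::complex_inner) = cnj a * cinner x y"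
  by (metis cinner_scaleC_left cinner_commute complex_cnj_mult)

lemma cinner_zero_left [simp]: "cinner (0::'a::complex_inner) x = 0"
  using cinner_add_left[of 0 0 x] by simp

lemma cinner_zero_right [simp]: "cinner x (0::'a::complex_inner) = 0"
  using cinner_add_right[of x 0 0] by simp

lemma cinner_minus_left [simp]: "cinner (- x::'a::complex_inner) y = - cinner x y"
  using cinner_add_left[of "-x" x y] by (simp add: eq_neg_iff_add_eq_0)

lemma cinner_minus_right [simp]: "cinner x (- y::'a::complex_inner) = - cinner x y"
  using cinner_add_right[of x "-y" y] by (simp add: eq_neg_iff_add_eq_0)

lemma cinner_diff_left: "cinner (x - y::'a::complex_inner) z = cinner x z - cinner y z"
  using cinner_add_left[of x "-y" z] by simp

lemma cinner_diff_right: "cinner x (y - z::'a::complex_inner) = cinner x y - cinner x z"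
  using cinner_add_right[of x y "-z"] by simp

lemmas cinner_algebra = cinner_add_left cinner_add_right cinner_diff_left cinner_diff_right
  cinner_scaleC_left cinner_scaleC_right

lemma norm_sq_cinner: "(norm (x::'a::complex_inner))\<^sup>2 = Re (cinner x x)"
  by (simp add: norm_cinner cinner_ge_zero)

lemma cinner_self: "cinner x (x::'a::complex_inner) = complex_of_real ((norm x)\<^sup>2)"
proof -
  have "Im (cinner x x) = 0"
    using cinner_commute[of x x] by (metis Im_complex_of_real complex_cnj_cancel_iff complex_is_Real_iff Reals_cnj_iff complex_of_real_def complex.sel(2))
  then show ?thesis
    by (simp add: complex_eq_iff norm_sq_cinner)
qed

lemma norm_scaleC: "norm (c *\<^sub>C (x::'a::complex_inner)) = cmod c * norm x"
proof -
  have "complex_of_real ((norm (c *\<^sub>C x))\<^sup>2) = complex_of_real ((cmod c * norm x)\<^sup>2)"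
    unfolding power_mult_distrib of_real_mult complex_norm_square
    unfolding cinner_self[symmetric] by (simp add: cinner_algebra)
  then have "(norm (c *\<^sub>C x))\<^sup>2 = (cmod c * norm x)\<^sup>2"
    using of_real_eq_iff by blast
  then show ?thesis by (simp add: power2_eq_iff_nonneg)
qed

lemma cauchy_schwarz: "cmod (cinner x (y::'a::complex_inner)) \<le> norm x * norm y"
proof (cases "y = 0")
  case False
  define c where "c = cinner x y / (norm y)\<^sup>2"
  have ny: "(norm y)\<^sup>2 \<noteq> 0" using False by simp
  have e: "cnj c * cinner x y = complex_of_real ((cmod (cinner x y))\<^sup>2 / (norm y)\<^sup>2)"
    unfolding c_def of_real_divide complex_norm_square by simp
  have "cinner (x - c *\<^sub>C y) (x - c *\<^sub>C y) =
     cinner x x - cnj c * cinner x y - c * (cinner y x - cnj c * cinner y y)"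
    by (simp add: cinner_algebra algebra_simps)
  also have "cinner y x - cnj c * cinner y y = 0"
    unfolding c_def cinner_self using ny by (simp add: cinner_commute[of y x])
  finally have "complex_of_real ((norm (x - c *\<^sub>C y))\<^sup>2) =
      complex_of_real ((norm x)\<^sup>2 - (cmod (cinner x y))\<^sup>2 / (norm y)\<^sup>2)"
    using e by (simp add: cinner_self)
  then have "(norm x)\<^sup>2 - (cmod (cinner x y))\<^sup>2 / (norm y)\<^sup>2 \<ge> 0"
    by (metis of_real_eq_iff zero_le_power2)
  then have "(cmod (cinner x y))\<^sup>2 \<le> (norm x * norm y)\<^sup>2"
    using ny by (simp add: field_simps power_mult_distrib)
  then show ?thesis by (simp add: power2_le_iff_abs_le)
qed simp

lemma bounded_bilinear_cinner: "bounded_bilinear (cinner :: 'a::complex_inner \<Rightarrow> 'a \<Rightarrow> complex)"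
proof
  show "\<exists>K. \<forall>a b::'a. norm (cinner a b) \<le> norm a * norm b * K"
    using cauchy_schwarz by (metis mult.right_neutral)
qed (simp_all add: cinner_algebra scaleR_scaleC scaleR_conv_of_real)

lemma bounded_bilinear_scaleC: "bounded_bilinear (scaleC :: complex \<Rightarrow> 'a::complex_inner \<Rightarrow> 'a)"
proof
  show "\<exists>K. \<forall>a (b::'a). norm (scaleC a b) \<le> norm a * norm b * K"
    using norm_scaleC by (metis mult.right_neutral order_refl)
qed (simp_all add: scaleC_algebra scaleR_scaleC scaleR_conv_of_real mult.commute)

lemmas tendsto_cinner [tendsto_intros] = bounded_bilinear.tendsto[OF bounded_bilinear_cinner]
lemmas tendsto_scaleC [tendsto_intros] = bounded_bilinear.tendsto[OF bounded_bilinear_scaleC]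
lemmas continuous_on_cinner [continuous_intros] = bounded_bilinear.continuous_on[OF bounded_bilinear_cinner]
lemmas continuous_on_scaleC [continuous_intros] = bounded_bilinear.continuous_on[OF bounded_bilinear_scaleC]

section \<open>Products of inner product spaces\<close>

instantiation prod :: (complex_inner, complex_inner) complex_inner
begin
definition "scaleC c p = (c *\<^sub>C fst p, c *\<^sub>C snd p)"
definition "cinner p q = cinner (fst p) (fst q) + cinner (snd p) (snd q)"
instance
proof
  fix a b :: complex and x y z :: "'a \<times> 'b" and r :: real
  show "cinner y x = cnj (cinner x y)"
    by (simp add: cinner_prod_def cinner_commute[of "fst y"] cinner_commute[of "snd y"])
  show "0 \<le> Re (cinner x x)"
    by (simp add: cinner_prod_def cinner_ge_zero)
  show "norm x = sqrt (Re (cinner x x))"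
    by (simp add: cinner_prod_def norm_prod_def cinner_self)
  show "x = 0" if "cinner x x = 0"
  proof -
    have "complex_of_real ((norm (fst x))\<^sup>2 + (norm (snd x))\<^sup>2) = 0"
      using that by (simp add: cinner_prod_def cinner_self)
    then have "(norm (fst x))\<^sup>2 + (norm (snd x))\<^sup>2 = 0"
      using of_real_eq_0_iff by blast
    then show ?thesis by (simp add: sum_power2_eq_zero_iff prod_eq_iff)
  qed
qed (auto simp: scaleC_prod_def cinner_prod_def scaleC_algebra scaleR_prod_def scaleR_scaleC
       cinner_algebra algebra_simps)
end

lemma scaleC_Pair [simp]: "c *\<^sub>C (x, y) = (c *\<^sub>C x, c *\<^sub>C y)"
  by (simp add: scaleC_prod_def)

lemma cinner_Pair [simp]: "cinner (a, b) (c, d) = cinner a c + cinner b d"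
  by (simp add: cinner_prod_def)

instance prod :: (chilbert, chilbert) chilbert ..
instance chilbert \<subseteq> banach ..

section \<open>Complex subspaces and their closures\<close>

definition csub :: "'a::complex_inner set \<Rightarrow> bool" where
  "csub S \<longleftrightarrow> 0 \<in> S \<and> (\<forall>x\<in>S. \<forall>y\<in>S. x + y \<in> S) \<and> (\<forall>c. \<forall>x\<in>S. c *\<^sub>C x \<in> S)"

lemma csub_0: "csub S \<Longrightarrow> 0 \<in> S"
  and csub_add: "csub S \<Longrightarrow> x \<in> S \<Longrightarrow> y \<in> S \<Longrightarrow> x + y \<in> S"
  and csub_scaleC: "csub S \<Longrightarrow> x \<in> S \<Longrightarrow> c *\<^sub>C x \<in> S"
  by (auto simp: csub_def)

lemma csub_diff: "csub S \<Longrightarrow> x \<in> S \<Longrightarrow> y \<in> S \<Longrightarrow> x - y \<in> S"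
  using csub_add[of S x "(-1) *\<^sub>C y"] csub_scaleC[of S y "-1"] by simp

lemma clin_rel_iff_csub: "clin_rel L \<longleftrightarrow> csub L"
  by (simp add: clin_rel_def csub_def zero_prod_def Ball_def split_paired_All)

lemma clin_brel_iff_csub: "clin_brel L \<longleftrightarrow> csub L"
  by (simp add: clin_brel_def csub_def zero_prod_def Ball_def split_paired_All)

lemma csub_closure:
  assumes "csub S" shows "csub (closure S)"
  unfolding csub_def
proof (intro conjI ballI allI)
  show "0 \<in> closure S" using assms by (meson closure_subset csub_0 subsetD)
next
  fix x y assume "x \<in> closure S" "y \<in> closure S"
  then obtain f g where "\<forall>n. f n \<in> S" "f \<longlonglongrightarrow> x" "\<forall>n. g n \<in> S" "g \<longlonglongrightarrow> y"
    by (auto simp: closure_sequential)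
  then show "x + y \<in> closure S"
    unfolding closure_sequential by (intro exI[of _ "\<lambda>n. f n + g n"]) (auto intro: tendsto_add csub_add assms)
next
  fix c x assume "x \<in> closure S"
  then obtain f where "\<forall>n. f n \<in> S" "f \<longlonglongrightarrow> x"
    by (auto simp: closure_sequential)
  then show "c *\<^sub>C x \<in> closure S"
    unfolding closure_sequential by (intro exI[of _ "\<lambda>n. c *\<^sub>C f n"]) (auto intro: tendsto_intros csub_scaleC assms)
qed

section \<open>Orthogonal projection and density by orthogonality\<close>

lemma parallelogram:
  "(norm (x + y::'a::complex_inner))\<^sup>2 + (norm (x - y))\<^sup>2 = 2 * (norm x)\<^sup>2 + 2 * (norm y)\<^sup>2"
  by (simp add: norm_sq_cinner cinner_algebra)

text \<open>A minimizing sequence is Cauchy: the midpoint of two of its members lies again in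
  \<open>S\<close>, so the parallelogram law bounds their distance by how far their squared
  distances to \<open>x\<close> exceed the infimum \<open>d\<close>.\<close>

lemma nearest_point_exists:
  fixes S :: "'a::chilbert set"
  assumes S: "csub S" "closed S"
  shows "\<exists>p\<in>S. \<forall>s\<in>S. norm (x - p) \<le> norm (x - s)"
proof -
  define d where "d = (INF s\<in>S. (norm (x - s))\<^sup>2)"
  have bdd: "bdd_below ((\<lambda>s. (norm (x - s))\<^sup>2) ` S)" by (rule bdd_belowI[of _ 0]) auto
  have ne: "S \<noteq> {}" using csub_0[OF S(1)] by auto
  have dle: "d \<le> (norm (x - s))\<^sup>2" if "s \<in> S" for s
    unfolding d_def by (rule cINF_lower[OF bdd that])
  have "\<exists>s\<in>S. (norm (x - s))\<^sup>2 < d + 1 / Suc n" for n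
    using cINF_less_iff[OF ne bdd, of "d + 1 / Suc n"] unfolding d_def[symmetric] by simp
  then obtain f where fS: "\<And>n. f n \<in> S" and f: "\<And>n. (norm (x - f n))\<^sup>2 < d + 1 / Suc n"
    by metis
  have close: "(norm (f m - f n))\<^sup>2 \<le> 2 / Suc m + 2 / Suc n" for m n
  proof -
    define c where "c = (1/2) *\<^sub>C (f m + f n)"
    have cS: "c \<in> S" unfolding c_def by (intro csub_scaleC csub_add S fS)
    have "f m + f n = 2 *\<^sub>C c" by (simp add: c_def scaleC_scaleC)
    moreover have "2 *\<^sub>C (x - c) = x + x - 2 *\<^sub>C c"
      using scaleC_add_left[of 1 1 x] by (simp add: scaleC_diff_right)
    ultimately have "(x - f m) + (x - f n) = 2 *\<^sub>C (x - c)"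
      by (simp add: algebra_simps)
    then have "(norm ((x - f m) + (x - f n)))\<^sup>2 = 4 * (norm (x - c))\<^sup>2"
      by (simp add: norm_scaleC power_mult_distrib)
    moreover have "(norm ((x - f m) - (x - f n)))\<^sup>2 = (norm (f m - f n))\<^sup>2"
      by (simp add: norm_minus_commute)
    ultimately have "(norm (f m - f n))\<^sup>2 = 2 * (norm (x - f m))\<^sup>2 + 2 * (norm (x - f n))\<^sup>2 - 4 * (norm (x - c))\<^sup>2"
      using parallelogram[of "x - f m" "x - f n"] by simp
    then show ?thesis using f[of m] f[of n] dle[OF cS] by simp
  qed
  have "Cauchy f"
  proof (rule metric_CauchyI)
    fix e :: real assume e: "e > 0"
    obtain N where N: "4 / e\<^sup>2 < real (Suc N)" using reals_Archimedean2 less_Suc_eq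
      by (metis lessI less_trans of_nat_less_iff)
    have "dist (f m) (f n) < e" if "m \<ge> N" "n \<ge> N" for m n
    proof -
      have "2 / Suc m + 2 / Suc n \<le> 2 / real (Suc N) + 2 / real (Suc N)"
        using that by (intro add_mono divide_left_mono) auto
      also have "\<dots> = 4 / real (Suc N)" by simp
      also have "\<dots> < e\<^sup>2" using N e by (simp add: field_simps)
      finally have "(norm (f m - f n))\<^sup>2 < e\<^sup>2" using close[of m n] by simp
      then show ?thesis using e by (simp add: dist_norm power2_less_imp_less)
    qed
    then show "\<exists>M. \<forall>m\<ge>M. \<forall>n\<ge>M. dist (f m) (f n) < e" by blast
  qed
  then obtain p where p: "f \<longlonglongrightarrow> p" using Cauchy_convergent convergent_def by blast
  have pS: "p \<in> S" using S(2) fS p closed_sequential_limits by blast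
  have "(\<lambda>n. (norm (x - f n))\<^sup>2) \<longlonglongrightarrow> (norm (x - p))\<^sup>2" by (intro tendsto_intros p)
  moreover have "(\<lambda>n. d + 1 / Suc n) \<longlonglongrightarrow> d + 0"
    by (intro tendsto_intros LIMSEQ_inverse_real_of_nat[unfolded inverse_eq_divide])
  ultimately have "(norm (x - p))\<^sup>2 \<le> d"
    using f by (intro LIMSEQ_le[of "\<lambda>n. (norm (x - f n))\<^sup>2" _ "\<lambda>n. d + 1 / Suc n"]) (auto intro: less_imp_le)
  then have "norm (x - p) \<le> norm (x - s)" if "s \<in> S" for s
    using dle[OF that] by (simp add: power2_le_imp_le)
  then show ?thesis using pS by blast
qed

text \<open>If \<open>x - p\<close> had a component along some \<open>s\<close> in \<open>S\<close>,
  moving the nearest point \<open>p\<close> by that component would shorten the squared distance by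
  \<open>|cinner (x - p) s|^2 / (norm s)^2\<close>, contradicting minimality.\<close>

lemma projection_exists:
  fixes S :: "'a::chilbert set"
  assumes S: "csub S" "closed S"
  shows "\<exists>p\<in>S. \<forall>s\<in>S. cinner (x - p) s = 0"
proof -
  obtain p where p: "p \<in> S" "\<And>s. s \<in> S \<Longrightarrow> norm (x - p) \<le> norm (x - s)"
    using nearest_point_exists[OF S] by blast
  have "cinner (x - p) s = 0" if s: "s \<in> S" for s
  proof (cases "s = 0")
    case False
    define u where "u = x - p"
    define c where "c = cinner u s / (norm s)\<^sup>2"
    have ns: "(norm s)\<^sup>2 > 0" using False by simp
    have e: "cnj c * cinner u s = complex_of_real ((cmod (cinner u s))\<^sup>2 / (norm s)\<^sup>2)"
      unfolding c_def of_real_divide complex_norm_square by simp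
    have "cinner (u - c *\<^sub>C s) (u - c *\<^sub>C s) =
       cinner u u - cnj c * cinner u s - c * (cinner s u - cnj c * cinner s s)"
      by (simp add: cinner_algebra algebra_simps)
    also have "cinner s u - cnj c * cinner s s = 0"
      unfolding c_def cinner_self using ns by (simp add: cinner_commute[of s u])
    finally have "(norm (u - c *\<^sub>C s))\<^sup>2 = (norm u)\<^sup>2 - (cmod (cinner u s))\<^sup>2 / (norm s)\<^sup>2"
      unfolding norm_sq_cinner[of "u - c *\<^sub>C s"] using e by (simp add: norm_sq_cinner)
    moreover have "norm u \<le> norm (u - c *\<^sub>C s)"
      using p(2)[of "p + c *\<^sub>C s"] by (simp add: u_def csub_add csub_scaleC S p(1) s diff_diff_eq)
    then have "(norm u)\<^sup>2 \<le> (norm (u - c *\<^sub>C s))\<^sup>2" by (simp add: power_mono)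
    ultimately have "(cmod (cinner u s))\<^sup>2 / (norm s)\<^sup>2 \<le> 0" by simp
    then show ?thesis using ns by (simp add: u_def divide_le_0_iff)
  qed simp
  then show ?thesis using p(1) by blast
qed

text \<open>The residual \<open>x - p\<close> of the projection onto the closure is orthogonal to
  \<open>S\<close>, hence by hypothesis to \<open>x\<close>, hence to itself. Many density and
  closure claims below are reduced to this test.\<close>

lemma in_closure_if_orthogonal:
  fixes S :: "'a::chilbert set"
  assumes "csub S" "\<And>y. (\<And>s. s \<in> S \<Longrightarrow> cinner s y = 0) \<Longrightarrow> cinner x y = 0"
  shows "x \<in> closure S"
proof -
  obtain p where p: "p \<in> closure S" "\<forall>s\<in>closure S. cinner (x - p) s = 0"
    using projection_exists[OF csub_closure[OF assms(1)] closed_closure] by blast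
  have o: "cinner s (x - p) = 0" if "s \<in> closure S" for s
    using p(2) that cinner_commute[of s "x - p"] by simp
  have "cinner x (x - p) = 0" using assms(2)[of "x - p"] o closure_subset by blast
  then have "cinner (x - p) (x - p) = 0" using o[OF p(1)] by (simp add: cinner_diff_left)
  then have "x = p" using cinner_eq_zero[of "x - p"] by simp
  then show ?thesis using p(1) by simp
qed

lemma dense_if_orthogonal:
  fixes S :: "'a::chilbert set"
  assumes "csub S" "\<And>y. (\<And>s. s \<in> S \<Longrightarrow> cinner s y = 0) \<Longrightarrow> y = 0"
  shows "closure S = UNIV"
  using in_closure_if_orthogonal[OF assms(1)] assms(2) by (metis UNIV_eq_I cinner_zero_right)

lemma eq_if_cinner_left: "(\<And>x. cinner x y = cinner x (z::'a::complex_inner)) \<Longrightarrow> y = z"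
  using cinner_eq_zero[of "y - z"] by (simp add: cinner_diff_right)

section \<open>Bounded operators\<close>

lemma bclin_bounded: "bclin T \<Longrightarrow> bounded_linear T"
  and bclin_scaleC: "bclin T \<Longrightarrow> T (c *\<^sub>C x) = c *\<^sub>C T x"
  by (auto simp: bclin_def)

lemma bclin_add: "bclin T \<Longrightarrow> T (x + y) = T x + T y"
  and bclin_diff: "bclin T \<Longrightarrow> T (x - y) = T x - T y"
  and bclin_zero: "bclin T \<Longrightarrow> T 0 = 0"
  by (auto simp: bclin_def linear_simps)

lemma bclin_tendsto: "bclin T \<Longrightarrow> (f \<longlongrightarrow> l) X \<Longrightarrow> ((\<lambda>x. T (f x)) \<longlongrightarrow> T l) X"
  by (rule bounded_linear.tendsto[OF bclin_bounded])

lemma bclin_continuous_on: "bclin T \<Longrightarrow> continuous_on S f \<Longrightarrow> continuous_on S (\<lambda>x. T (f x))"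
  by (rule bounded_linear.continuous_on[OF bclin_bounded])

lemma bclinI:
  assumes "\<And>x y. T (x + y) = T x + T y" "\<And>c x. T (c *\<^sub>C x) = c *\<^sub>C T x"
    "\<And>x. norm (T x) \<le> norm x * C"
  shows "bclin T"
  unfolding bclin_def using assms(2)
  by (auto intro!: bounded_linear_intro[of _ C] assms simp: scaleR_scaleC)

section \<open>Riesz representation and bounded adjoints\<close>

lemma riesz:
  fixes \<phi> :: "'a::chilbert \<Rightarrow> complex"
  assumes add: "\<And>x y. \<phi> (x + y) = \<phi> x + \<phi> y" and scale: "\<And>c x. \<phi> (c *\<^sub>C x) = c * \<phi> x"
    and bd: "\<And>x. cmod (\<phi> x) \<le> norm x * C"
  shows "\<exists>s. \<forall>x. \<phi> x = cinner x s"
proof (cases "\<forall>x. \<phi> x = 0")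
  case False
  then obtain x where x: "\<phi> x \<noteq> 0" by blast
  have bl: "bounded_linear \<phi>"
    by (rule bounded_linear_intro[of _ C]) (auto simp: add bd scale scaleR_scaleC scaleR_conv_of_real)
  \<comment> \<open>The representing vector will be a multiple of \<open>e\<close>, the component of
    \<open>x\<close> orthogonal to the kernel \<open>N\<close>: every \<open>y\<close> differs from
    a multiple of \<open>e\<close> by an element of \<open>N\<close>.\<close>
  define N where "N = {x. \<phi> x = 0}"
  have d: "\<phi> (a - b) = \<phi> a - \<phi> b" for a b using bl by (simp add: linear_simps)
  have "csub N" using scale[of 0 0] by (auto simp: csub_def N_def add scale)
  moreover have "closed N" unfolding N_def
    by (intro closed_Collect_eq continuous_intros bounded_linear.continuous_on[OF bl])
  ultimately obtain p where p: "p \<in> N" "\<forall>s\<in>N. cinner (x - p) s = 0"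
    using projection_exists by blast
  define e where "e = x - p"
  have pe: "\<phi> e \<noteq> 0" using x p(1) by (simp add: e_def d N_def)
  then have e0: "e \<noteq> 0" using scale[of 0 0] by auto
  define s where "s = (cnj (\<phi> e) / (norm e)\<^sup>2) *\<^sub>C e"
  have "\<phi> y = cinner y s" for y
  proof -
    have "\<phi> (y - (\<phi> y / \<phi> e) *\<^sub>C e) = 0" using pe by (simp add: d scale)
    then have "cinner e (y - (\<phi> y / \<phi> e) *\<^sub>C e) = 0" using p(2) by (simp add: N_def e_def)
    then have "cinner (y - (\<phi> y / \<phi> e) *\<^sub>C e) e = 0" using cinner_commute[of "y - (\<phi> y / \<phi> e) *\<^sub>C e" e] by simp
    then have "cinner y e = \<phi> y / \<phi> e * (norm e)\<^sup>2" by (simp add: cinner_algebra cinner_self)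
    then show ?thesis using e0 pe by (simp add: s_def cinner_scaleC_right)
  qed
  then show ?thesis by blast
qed (auto intro: exI[of _ 0])

text \<open>Riesz representation is applied to the functional
  \<open>x \<mapsto> cinner (T x) y\<close> for each \<open>y\<close>. The bound for
  \<open>S\<close> comes from \<open>(norm (S y))^2 = cinner (T (S y)) y\<close>.\<close>

lemma adjoint_exists:
  fixes T :: "'a::chilbert \<Rightarrow> 'b::complex_inner"
  assumes T: "bclin T"
  shows "\<exists>S. bclin S \<and> is_adj T S"
proof -
  obtain C where C: "\<And>x. norm (T x) \<le> norm x * C" "C \<ge> 0"
    using bounded_linear.nonneg_bounded[OF bclin_bounded[OF T]] by blast
  have "\<exists>s. \<forall>x. cinner (T x) y = cinner x s" for y
  proof (rule riesz[of _ "C * norm y"])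
    fix x
    have "cmod (cinner (T x) y) \<le> norm (T x) * norm y" by (rule cauchy_schwarz)
    also have "\<dots> \<le> norm x * C * norm y" by (intro mult_right_mono C) simp
    finally show "cmod (cinner (T x) y) \<le> norm x * (C * norm y)" by (simp add: mult.assoc)
  qed (simp_all add: bclin_add[OF T] bclin_scaleC[OF T] cinner_algebra)
  then obtain S where S: "\<And>x y. cinner (T x) y = cinner x (S y)" by metis
  have "bclin S"
  proof (rule bclinI[of _ C])
    show "S (x + y) = S x + S y" for x y
      by (rule eq_if_cinner_left) (simp add: cinner_algebra S[symmetric])
    show "S (c *\<^sub>C x) = c *\<^sub>C S x" for c x
      by (rule eq_if_cinner_left) (simp add: cinner_algebra S[symmetric])
    fix y
    have "(norm (S y))\<^sup>2 = cmod (cinner (T (S y)) y)"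
      by (simp add: S cinner_self norm_power)
    also have "\<dots> \<le> norm (T (S y)) * norm y" by (rule cauchy_schwarz)
    also have "\<dots> \<le> norm (S y) * C * norm y" by (intro mult_right_mono C) simp
    finally have "norm (S y) * norm (S y) \<le> norm (S y) * (norm y * C)"
      by (simp add: power2_eq_square mult_ac)
    then show "norm (S y) \<le> norm y * C"
      using C(2) by (cases "norm (S y) = 0") (auto simp: mult_le_cancel_left)
  qed
  then show ?thesis using S by (auto simp: is_adj_def)
qed

lemma dense_sequence: "closure S = UNIV \<Longrightarrow> \<exists>f. (\<forall>n. f n \<in> S) \<and> f \<longlonglongrightarrow> x"
  for x :: "'a::first_countable_topology"
  using closure_sequential[of x S] by simp

text \<open>With \<open>C = 1 - B\<close>, the iteration \<open>Y \<mapsto> (C + Y\<^sup>2)/2\<close> is majorized in norm by the scalar iteration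
  \<open>y \<mapsto> (1 + y\<^sup>2)/2\<close>, and a fixed point satisfies \<open>(1 - Y)\<^sup>2 = B\<close>.\<close>

lemma sqrt_operator_exists:
  fixes B :: "'a::chilbert \<Rightarrow> 'a"
  assumes B: "bclin B" and adj: "is_adj B B" and contr: "\<And>x. norm (x - B x) \<le> norm x"
  shows "\<exists>G. bclin G \<and> is_adj G G \<and> (\<forall>x. G (G x) = B x)"
proof -
  define C where "C = Blinfun (\<lambda>x. x - B x)"
  have C: "blinfun_apply C x = x - B x" for x
    unfolding C_def
    by (simp add: bounded_linear_Blinfun_apply bounded_linear_sub[OF bounded_linear_ident bclin_bounded[OF B]])
  have normC: "norm C \<le> 1" using contr by (intro norm_blinfun_bound) (auto simp: C)
  define Y :: "nat \<Rightarrow> 'a \<Rightarrow>\<^sub>L 'a" where "Y n = ((\<lambda>Z. (1/2) *\<^sub>R (C + (Z o\<^sub>L Z))) ^^ n) 0" for n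
  define y :: "nat \<Rightarrow> real" where "y n = ((\<lambda>t. (1 + t * t) / 2) ^^ n) 0" for n
  have Y0: "Y 0 = 0" and YS: "Y (Suc n) = (1/2) *\<^sub>R (C + (Y n o\<^sub>L Y n))" for n
    by (simp_all add: Y_def)
  have y0: "y 0 = 0" and yS: "y (Suc n) = (1 + y n * y n) / 2" for n
    by (simp_all add: y_def)
  have y1: "0 \<le> y n \<and> y n \<le> 1" for n
    by (induction n) (auto simp: y0 yS mult_le_one)
  have nY: "norm (Y n) \<le> y n" for n
  proof (induction n)
    case (Suc n)
    have "norm (Y n o\<^sub>L Y n) \<le> y n * y n"
      using norm_blinfun_compose[of "Y n" "Y n"] mult_mono[OF Suc Suc] y1[of n] by simp
    then have "norm (C + (Y n o\<^sub>L Y n)) \<le> 1 + y n * y n"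
      using norm_triangle_le normC by (metis add_mono order_trans norm_triangle_ineq)
    then show ?case by (simp add: YS yS)
  qed (simp add: Y0 y0)
  have dY: "norm (Y (Suc n) - Y n) \<le> y (Suc n) - y n" for n
  proof (induction n)
    case 0
    show ?case using normC by (simp add: YS Y0 yS y0)
  next
    case (Suc n)
    define D where "D = Y (Suc n) - Y n"
    have "Y (Suc (Suc n)) - Y (Suc n) = (1/2) *\<^sub>R ((Y (Suc n) o\<^sub>L Y (Suc n)) - (Y n o\<^sub>L Y n))"
      by (simp add: YS[of "Suc n"] YS[of n] algebra_simps)
    \<comment> \<open>A difference of squares factored without assuming that
      \<open>Y (Suc n)\<close> and \<open>Y n\<close> commute.\<close>
    also have "(Y (Suc n) o\<^sub>L Y (Suc n)) - (Y n o\<^sub>L Y n) = (Y (Suc n) o\<^sub>L D) + (D o\<^sub>L Y n)"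
      by (rule blinfun_eqI) (simp add: D_def blinfun.bilinear_simps)
    finally have eq: "Y (Suc (Suc n)) - Y (Suc n) = (1/2) *\<^sub>R ((Y (Suc n) o\<^sub>L D) + (D o\<^sub>L Y n))" .
    have d: "norm D \<le> y (Suc n) - y n" using Suc by (simp add: D_def)
    have "norm (Y (Suc n) o\<^sub>L D) \<le> y (Suc n) * (y (Suc n) - y n)"
      using norm_blinfun_compose[of "Y (Suc n)" D] mult_mono[OF nY[of "Suc n"] d] y1[of "Suc n"]
      by simp
    moreover have "norm (D o\<^sub>L Y n) \<le> (y (Suc n) - y n) * y n"
      using norm_blinfun_compose[of D "Y n"] mult_mono[OF d nY[of n]] y1[of n]
        norm_ge_zero[of D] norm_ge_zero[of "Y n"] d by linarith
    ultimately have "norm ((Y (Suc n) o\<^sub>L D) + (D o\<^sub>L Y n)) \<le> y (Suc n) * y (Suc n) - y n * y n"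
      using norm_triangle_ineq[of "Y (Suc n) o\<^sub>L D" "D o\<^sub>L Y n"] by (simp add: algebra_simps)
    then show ?case unfolding eq by (simp add: yS[of "Suc n"] yS[of n] diff_divide_distrib[symmetric])
  qed
  \<comment> \<open>The increments telescope, so \<open>Y\<close> is Cauchy as soon as the
    increasing scalar sequence \<open>y\<close>, bounded by 1, is.\<close>
  have dYm: "norm (Y (n + k) - Y n) \<le> y (n + k) - y n" for n k
  proof (induction k)
    case (Suc k)
    show ?case using norm_triangle_ineq[of "Y (Suc (n + k)) - Y (n + k)" "Y (n + k) - Y n"] dY[of "n + k"] Suc
      by simp
  qed simp
  have "incseq y" using dY by (intro incseq_SucI) (smt (verit) norm_ge_zero)
  then have "convergent y" using y1 by (intro Bseq_monoseq_convergent BseqI'[of _ 1]) (auto simp: incseq_imp_monoseq)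
  then have Cy: "Cauchy y" by (rule convergent_Cauchy)
  have "Cauchy Y"
  proof (rule CauchyI')
    fix e :: real assume "e > 0"
    then obtain M where M: "\<forall>m\<ge>M. \<forall>n\<ge>M. norm (y m - y n) < e" using CauchyD[OF Cy] by blast
    have "dist (Y m) (Y n) < e" if "m \<ge> M" "n > m" for m n
    proof -
      have "norm (Y n - Y m) \<le> y n - y m" using dYm[of m "n - m"] that by simp
      also have "\<dots> < e" using M that by (metis abs_le_D1 le_less_trans less_imp_le order.trans real_norm_def order_refl)
      finally show ?thesis by (simp add: dist_norm norm_minus_commute)
    qed
    then show "\<exists>M. \<forall>m\<ge>M. \<forall>n>m. dist (Y m) (Y n) < e" by blast
  qed
  then obtain L where L: "Y \<longlonglongrightarrow> L" using Cauchy_convergent convergent_def by blast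
  have "(\<lambda>n. Y (Suc n)) \<longlonglongrightarrow> (1/2) *\<^sub>R (C + (L o\<^sub>L L))"
    unfolding YS by (intro tendsto_intros bounded_bilinear.tendsto[OF bounded_bilinear_blinfun_compose] L)
  then have Leq: "L = (1/2) *\<^sub>R (C + (L o\<^sub>L L))"
    using LIMSEQ_Suc[OF L] LIMSEQ_unique by blast
  have Lx: "(\<lambda>n. blinfun_apply (Y n) x) \<longlonglongrightarrow> blinfun_apply L x" for x
    by (intro tendsto_intros L)
  \<comment> \<open>The type of bounded operators used here knows only real linearity, so complex
    linearity and symmetry are carried along the iteration and passed to the limit \<open>L\<close>
    pointwise.\<close>
  have Yc: "blinfun_apply (Y n) (c *\<^sub>C x) = c *\<^sub>C blinfun_apply (Y n) x" for n c x
  proof (induction n arbitrary: x)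
    case (Suc n)
    show ?case by (simp add: YS blinfun.bilinear_simps C Suc bclin_scaleC[OF B] scaleC_algebra scaleR_scaleC mult.commute)
  qed (simp add: Y0)
  have Ya: "cinner (blinfun_apply (Y n) x) z = cinner x (blinfun_apply (Y n) z)" for n x z
  proof (induction n arbitrary: x z)
    case (Suc n)
    show ?case using adj by (simp add: YS blinfun.bilinear_simps C Suc scaleR_scaleC cinner_algebra is_adj_def)
  qed (simp add: Y0)
  have Lc: "blinfun_apply L (c *\<^sub>C x) = c *\<^sub>C blinfun_apply L x" for c x
    using tendsto_scaleC[OF tendsto_const Lx[of x], of c] Lx[of "c *\<^sub>C x"] LIMSEQ_unique unfolding Yc by blast
  have La: "cinner (blinfun_apply L x) z = cinner x (blinfun_apply L z)" for x z
    using tendsto_cinner[OF Lx[of x] tendsto_const, of z] tendsto_cinner[OF tendsto_const Lx[of z], of x]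
      LIMSEQ_unique unfolding Ya by blast
  define G where "G x = x - blinfun_apply L x" for x
  have "G (G x) = B x" for x
  proof -
    have "blinfun_apply L x = (1/2) *\<^sub>R (x - B x + blinfun_apply L (blinfun_apply L x))"
      by (subst Leq) (simp add: blinfun.bilinear_simps C)
    then have "blinfun_apply L x + blinfun_apply L x = x - B x + blinfun_apply L (blinfun_apply L x)"
      by (metis scaleR_half_double scaleR_add_right)
    then show ?thesis by (simp add: G_def blinfun.bilinear_simps algebra_simps)
  qed
  moreover have "bclin G"
    unfolding bclin_def G_def
    by (auto intro!: bounded_linear_sub bounded_linear_ident blinfun.bounded_linear_right simp: scaleC_algebra Lc)
  moreover have "is_adj G G" by (simp add: is_adj_def G_def cinner_algebra La)
  ultimately show ?thesis by blast
qed

section \<open>Projection operators, dense ranges and isometries\<close>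

lemma csub_range:
  assumes T: "bclin T" shows "csub (range T)"
  unfolding csub_def
proof (intro conjI ballI allI)
  show "0 \<in> range T" using bclin_zero[OF T] by (metis rangeI)
  show "x + y \<in> range T" if "x \<in> range T" "y \<in> range T" for x y
    using that by (auto simp: bclin_add[OF T, symmetric])
  show "c *\<^sub>C x \<in> range T" if "x \<in> range T" for c x
    using that by (auto simp: bclin_scaleC[OF T, symmetric])
qed

text \<open>Orthogonality of the residual determines the projected point, so the chosen points
  depend linearly on \<open>x\<close>. The estimate for \<open>x - P x\<close> supplies the
  contraction hypothesis when a square root is taken later.\<close>

lemma projection_operator_exists:
  fixes S :: "'a::chilbert set"
  assumes S: "csub S" "closed S"
  shows "\<exists>P. bclin P \<and> is_adj P P \<and> (\<forall>x. P x \<in> S) \<and> (\<forall>s\<in>S. P s = s) \<and> (\<forall>x. norm (x - P x) \<le> norm x)"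
proof -
  obtain P where PS: "\<And>x. P x \<in> S" and Po: "\<And>x s. s \<in> S \<Longrightarrow> cinner (x - P x) s = 0"
    using projection_exists[OF S] by metis
  have Po': "cinner s (x - P x) = 0" if "s \<in> S" for x s
    using Po[OF that] cinner_commute[of s "x - P x"] by simp
  have uniq: "P x = p" if "p \<in> S" "\<And>s. s \<in> S \<Longrightarrow> cinner (x - p) s = 0" for x p
  proof -
    have m: "P x - p \<in> S" by (intro csub_diff S PS that)
    have "cinner (x - p - (x - P x)) (P x - p) = 0"
      unfolding cinner_diff_left[of "x - p"] that(2)[OF m] Po[OF m] by simp
    then show ?thesis using cinner_eq_zero[of "P x - p"] by simp
  qed
  have pyth: "(norm x)\<^sup>2 = (norm (x - P x))\<^sup>2 + (norm (P x))\<^sup>2" for x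
  proof -
    have "cinner x x = cinner ((x - P x) + P x) ((x - P x) + P x)" by simp
    also have "\<dots> = cinner (x - P x) (x - P x) + cinner (P x) (P x)"
      unfolding cinner_add_left cinner_add_right using Po[OF PS, of x x] Po'[OF PS, of x x] by simp
    finally show ?thesis by (simp add: norm_sq_cinner)
  qed
  have "bclin P"
  proof (rule bclinI[of _ 1])
    show "P (x + y) = P x + P y" for x y
    proof (rule uniq)
      fix s assume "s \<in> S"
      then show "cinner (x + y - (P x + P y)) s = 0"
        using Po[of s x] Po[of s y] by (simp add: cinner_algebra)
    qed (intro csub_add S PS)
    show "P (c *\<^sub>C x) = c *\<^sub>C P x" for c x
    proof (rule uniq)
      fix s assume "s \<in> S"
      then show "cinner (c *\<^sub>C x - c *\<^sub>C P x) s = 0"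
        using Po[of s x] by (simp add: cinner_algebra)
    qed (intro csub_scaleC S PS)
    show "norm (P x) \<le> norm x * 1" for x
      using pyth[of x] by (simp add: power2_le_imp_le)
  qed
  moreover have "is_adj P P"
    unfolding is_adj_def
  proof (intro allI)
    fix x y
    have "cinner (P x) (y - P y) = 0" "cinner (x - P x) (P y) = 0" by (simp_all add: Po Po' PS)
    then show "cinner (P x) y = cinner x (P y)" by (simp add: cinner_algebra)
  qed
  moreover have "P s = s" if "s \<in> S" for s by (rule uniq) (use that in auto)
  moreover have "norm (x - P x) \<le> norm x" for x using pyth[of x] by (simp add: power2_le_imp_le)
  ultimately show ?thesis using PS by blast
qed

lemma orthogonal_dense_eq_0:
  fixes S :: "'a::complex_inner set"
  assumes "closure S = UNIV" "\<And>s. s \<in> S \<Longrightarrow> cinner s y = 0"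
  shows "y = 0"
proof -
  obtain f where f: "\<forall>n. f n \<in> S" "f \<longlonglongrightarrow> y"
    using dense_sequence[OF assms(1)] by blast
  have "(\<lambda>n. cinner (f n) y) \<longlonglongrightarrow> cinner y y" by (intro tendsto_intros f)
  moreover have "(\<lambda>n. cinner (f n) y) = (\<lambda>n. 0)" using f(1) assms(2) by auto
  ultimately have "cinner y y = 0" by (simp add: LIMSEQ_const_iff)
  then show ?thesis by (rule cinner_eq_zero)
qed


text \<open>A vector \<open>y\<close> orthogonal to the range satisfies
  \<open>0 = cinner (G (G y)) y = (norm (G y))^2\<close>, and injectivity finishes.\<close>

lemma selfadjoint_range_dense:
  fixes G :: "'b::chilbert \<Rightarrow> 'b"
  assumes G: "bclin G" "is_adj G G" and inj: "\<And>x. G x = 0 \<Longrightarrow> x = 0"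
  shows "closure (range G) = UNIV"
proof (rule dense_if_orthogonal)
  show "csub (range G)" by (rule csub_range[OF G(1)])
  fix y assume "\<And>s. s \<in> range G \<Longrightarrow> cinner s y = 0"
  then have "cinner (G (G y)) y = 0" by blast
  then have "cinner (G y) (G y) = 0" using G(2) unfolding is_adj_def by metis
  then show "y = 0" by (rule inj[OF cinner_eq_zero])
qed

lemma isometric_limit:
  fixes V :: "'a::banach \<Rightarrow> 'b::real_normed_vector"
  assumes V: "bounded_linear V" "\<And>x. norm (V x) = norm x" and q: "(\<lambda>n. V (x n)) \<longlonglongrightarrow> q"
  shows "\<exists>l. x \<longlonglongrightarrow> l \<and> q = V l"
proof -
  have d: "dist (V a) (V b) = dist a b" for a b
    using V(2)[of "a - b"] by (simp add: dist_norm linear_simps[OF V(1)])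
  have "Cauchy x" using LIMSEQ_imp_Cauchy[OF q] by (simp add: Cauchy_def d)
  then obtain l where l: "x \<longlonglongrightarrow> l" using Cauchy_convergent convergent_def by blast
  then show ?thesis using bounded_linear.tendsto[OF V(1) l] q LIMSEQ_unique by blast
qed

text \<open>Read \<open>T\<close> as the graph of a closed densely defined operator. Projecting
  \<open>(h, 0)\<close> onto the graph and taking the first component gives
  \<open>(1 + T* T)^-1\<close>. Its square root is \<open>G\<close>, and \<open>K\<close> is
  \<open>T G\<close>. The last conjunct then says \<open>G^2 + K* K = 1\<close>, so the graph is
  parametrized isometrically.\<close>

lemma closed_operator_factorization:
  fixes T :: "('b::chilbert \<times> 'a::chilbert) set"
  assumes T: "csub T" "closed T" and op: "\<And>f. (0, f) \<in> T \<Longrightarrow> f = 0" and dense: "closure (rdom T) = UNIV"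
  shows "\<exists>G K. bclin G \<and> bclin K \<and> is_adj G G \<and> (\<forall>x. G x = 0 \<longrightarrow> x = 0)
    \<and> T = range (\<lambda>x. (G x, K x)) \<and> (\<forall>x. norm (G x, K x) = norm x)"
proof -
  obtain P where P: "bclin P" "is_adj P P" and PT: "\<And>q. P q \<in> T" and Pid: "\<And>q. q \<in> T \<Longrightarrow> P q = q"
    and Pn: "\<And>q. norm (q - P q) \<le> norm q"
    using projection_operator_exists[OF T] by metis
  have Padj: "cinner (P p) q = cinner p (P q)" for p q using P(2) unfolding is_adj_def by blast
  define Q where "Q h = P (h, 0)" for h
  have QT: "Q h \<in> T" for h by (simp add: Q_def PT)
  have QQ: "cinner (Q h) q = cinner h (fst q)" if "q \<in> T" for h q
    using Padj[of "(h, 0)" q] Pid[OF that] by (simp add: Q_def cinner_prod_def)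
  have Q: "bclin Q"
  proof (rule bclinI)
    show "Q (x + y) = Q x + Q y" for x y using bclin_add[OF P(1), of "(x, 0)" "(y, 0)"] by (simp add: Q_def)
    show "Q (c *\<^sub>C x) = c *\<^sub>C Q x" for c x using bclin_scaleC[OF P(1), of c "(x, 0)"] by (simp add: Q_def)
    show "norm (Q x) \<le> norm x * onorm P" for x
      using onorm[OF bclin_bounded[OF P(1)], of "(x, 0)"] by (simp add: Q_def mult.commute norm_Pair)
  qed
  define B where "B h = fst (Q h)" for h
  have "bclin B"
  proof (rule bclinI)
    show "norm (B x) \<le> norm x * onorm Q" for x
      using onorm[OF bclin_bounded[OF Q], of x] norm_fst_le[of "fst (Q x)" "snd (Q x)"] by (simp add: B_def mult.commute)
  qed (simp_all add: B_def bclin_add[OF Q] bclin_scaleC[OF Q] scaleC_prod_def)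
  moreover have BQ: "cinner (B h) k = cinner (Q h) (Q k)" for h k
    using QQ[OF QT, of k h] cinner_commute[of k] cinner_commute[of "Q k"] by (simp add: B_def)
  have BQ': "cinner h (B k) = cinner (Q h) (Q k)" for h k
    using QQ[OF QT, of h k] by (simp add: B_def)
  have "is_adj B B" by (simp add: is_adj_def BQ BQ')
  moreover have "norm (h - B h) \<le> norm h" for h
    using norm_fst_le[of "h - B h" "snd ((h, 0) - Q h)"] Pn[of "(h, 0)"]
    by (simp add: Q_def B_def minus_prod_def)
  ultimately obtain G where G: "bclin G" "is_adj G G" "\<And>h. G (G h) = B h"
    using sqrt_operator_exists by metis
  have Gadj: "cinner (G x) y = cinner x (G y)" for x y using G(2) unfolding is_adj_def by blast
  \<comment> \<open>This makes \<open>G h \<mapsto> Q h\<close> isometric, which allows it to be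
    extended from the dense range of \<open>G\<close> to all vectors.\<close>
  have nQ: "norm (Q h) = norm (G h)" for h
  proof -
    have "(norm (Q h))\<^sup>2 = (norm (G h))\<^sup>2"
      by (simp only: norm_sq_cinner BQ[symmetric] G(3)[symmetric] Gadj)
    then show ?thesis by (simp add: power2_eq_iff_nonneg)
  qed
  have inj: "h = 0" if "G h = 0" for h
  proof (rule orthogonal_dense_eq_0[OF dense])
    fix s assume "s \<in> rdom T"
    then obtain q where "q \<in> T" "s = fst q" by (auto simp: rdom_def)
    moreover have "Q h = 0" using nQ[of h] that by simp
    ultimately show "cinner s h = 0" using QQ[of q h] cinner_commute[of s h] by simp
  qed
  have rangeG: "closure (range G) = UNIV" by (rule selfadjoint_range_dense[OF G(1,2) inj])
  \<comment> \<open>Approximate \<open>x\<close> by vectors \<open>G (h n)\<close>. The points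
    \<open>Q (h n)\<close> of the graph then converge, and since \<open>fst (Q h) = G (G h)\<close>
    the limit has first component \<open>G x\<close>.\<close>
  have "\<exists>k. (G x, k) \<in> T \<and> norm (G x, k) = norm x" for x
  proof -
    obtain g where g: "\<forall>n. g n \<in> range G" "g \<longlonglongrightarrow> x"
      using dense_sequence[OF rangeG] by blast
    then have "\<forall>n. \<exists>k. g n = G k" by blast
    then obtain h' where "\<forall>n. g n = G (h' n)" by metis
    then have "g = (\<lambda>n. G (h' n))" by blast
    then obtain h where h: "(\<lambda>n. G (h n)) \<longlonglongrightarrow> x" using g(2) by blast
    have d: "dist (Q a) (Q b) = dist (G a) (G b)" for a b
      using nQ[of "a - b"] by (simp add: dist_norm bclin_diff[OF Q] bclin_diff[OF G(1)])
    have "Cauchy (\<lambda>n. Q (h n))" using LIMSEQ_imp_Cauchy[OF h] by (simp add: Cauchy_def d)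
    then obtain q where q: "(\<lambda>n. Q (h n)) \<longlonglongrightarrow> q" using Cauchy_convergent convergent_def by blast
    have "q \<in> T" by (rule closed_sequentially[OF T(2) QT q])
    moreover have "fst q = G x"
      using tendsto_fst[OF q] bclin_tendsto[OF G(1) h] LIMSEQ_unique by (auto simp: B_def[symmetric] G(3))
    moreover have "norm q = norm x"
      using tendsto_norm[OF q] tendsto_norm[OF h] LIMSEQ_unique by (auto simp: nQ)
    ultimately show ?thesis by (metis prod.collapse)
  qed
  then obtain K where KT: "\<And>x. (G x, K x) \<in> T" and n: "\<And>x. norm (G x, K x) = norm x" by metis
  have uniq: "K x = k" if "(G x, k) \<in> T" for x k
    using op[of "K x - k"] csub_diff[OF T(1) KT[of x] that] by simp
  have K: "bclin K"
  proof (rule bclinI[of _ 1])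
    show "K (x + y) = K x + K y" for x y
      using csub_add[OF T(1) KT KT, of x y] by (intro uniq) (simp add: bclin_add[OF G(1)])
    show "K (c *\<^sub>C x) = c *\<^sub>C K x" for c x
      using csub_scaleC[OF T(1) KT, of c x] by (intro uniq) (simp add: bclin_scaleC[OF G(1)])
    show "norm (K x) \<le> norm x * 1" for x using norm_snd_le[of "K x" "G x"] n[of x] by simp
  qed
  define V where "V x = (G x, K x)" for x
  have V: "bounded_linear V" unfolding V_def by (intro bounded_linear_Pair bclin_bounded G K)
  have Vn: "norm (V x) = norm x" for x by (simp add: V_def n)
  have "closed (range V)"
    unfolding closed_sequential_limits
  proof (intro allI impI)
    fix v q assume a: "(\<forall>n. v n \<in> range V) \<and> v \<longlonglongrightarrow> q"
    then have "\<forall>n. \<exists>k. v n = V k" by blast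
    then obtain x where "\<forall>n. v n = V (x n)" by metis
    then have "v = (\<lambda>n. V (x n))" by blast
    then have "(\<lambda>n. V (x n)) \<longlonglongrightarrow> q" using a by simp
    then show "q \<in> range V" using isometric_limit[OF V Vn] by blast
  qed
  have "bclin V" unfolding bclin_def using V by (simp add: V_def bclin_scaleC[OF G(1)] bclin_scaleC[OF K])
  then have "csub (range V)" by (rule csub_range)
  \<comment> \<open>Density of the range of \<open>V\<close> in \<open>T\<close>: each
    \<open>Q h\<close> equals \<open>V (G h)\<close>, so \<open>y\<close> orthogonal to the range
    has \<open>fst (P y) = 0\<close>, and single-valuedness of \<open>T\<close> turns this into
    \<open>P y = 0\<close>.\<close>
  moreover have "cinner q y = 0" if q: "q \<in> T" and y: "\<And>s. s \<in> range V \<Longrightarrow> cinner s y = 0" for q y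
  proof -
    have "cinner h (fst (P y)) = 0" for h
    proof -
      have "Q h = V (G h)" using uniq[of "G h" "snd (Q h)"] QT[of h] by (simp add: V_def G(3) B_def)
      then have "cinner (Q h) y = 0" using y by blast
      then show ?thesis using Padj[of "(h, 0)" y] by (simp add: Q_def cinner_prod_def)
    qed
    then have "fst (P y) = 0" using cinner_eq_zero by blast
    then have "P y = 0" using op[of "snd (P y)"] PT[of y] by (metis prod.collapse zero_prod_def)
    then show ?thesis using Padj[of q y] Pid[OF q] by simp
  qed
  ultimately have "T \<subseteq> closure (range V)" using in_closure_if_orthogonal by blast
  then have "T = range V" using \<open>closed (range V)\<close> KT by (auto simp: V_def)
  then have "T = range (\<lambda>x. (G x, K x))" by (simp add: V_def)
  then show ?thesis
    by (intro exI[of _ G] exI[of _ K]) (use G(1,2) K inj n in simp)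
qed

section \<open>Selfadjoint relations\<close>

lemma radj_iff: "(h, h') \<in> radj L \<longleftrightarrow> (\<forall>f f'. (f, f') \<in> L \<longrightarrow> cinner f' h = cinner f h')"
  by (auto simp: radj_def)

lemma csub_radj: "csub (radj L)"
  unfolding csub_def
proof (intro conjI ballI allI)
  show "0 \<in> radj L" by (simp add: radj_iff zero_prod_def)
  show "p + q \<in> radj L" if "p \<in> radj L" "q \<in> radj L" for p q
    using that by (cases p, cases q) (simp add: radj_iff cinner_add_right)
  show "c *\<^sub>C p \<in> radj L" if "p \<in> radj L" for c p
    using that by (cases p) (simp add: radj_iff cinner_scaleC_right)
qed

lemma closed_radj: "closed (radj L)"
proof -
  have "radj L = (\<Inter>(f, f')\<in>L. {p. cinner f' (fst p) = cinner f (snd p)})"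
    by (auto simp: radj_def)
  then show ?thesis
    by (auto intro!: closed_INT closed_Collect_eq continuous_intros)
qed

lemma radj_closure: "radj (closure L) = radj L"
proof (intro equalityI subrelI)
  fix h h' assume a: "(h, h') \<in> radj L"
  have "cinner f' h = cinner f h'" if "(f, f') \<in> closure L" for f f'
  proof -
    have "closed {p. cinner (snd p) h = cinner (fst p) h'}" by (intro closed_Collect_eq continuous_intros)
    moreover have "L \<subseteq> {p. cinner (snd p) h = cinner (fst p) h'}" using a by (auto simp: radj_iff)
    ultimately have "closure L \<subseteq> {p. cinner (snd p) h = cinner (fst p) h'}" by (rule closure_minimal[rotated])
    then show ?thesis using that by auto
  qed
  then show "(h, h') \<in> radj (closure L)" by (simp add: radj_iff)
next
  fix h h' assume "(h, h') \<in> radj (closure L)"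
  then show "(h, h') \<in> radj L" using closure_subset[of L] by (auto simp: radj_iff)
qed

text \<open>Symmetry makes \<open>cinner (z f + y) f\<close> real; comparing imaginary parts gives
  the estimate. Here \<open>y\<close> plays the part of \<open>(S - z) f\<close>.\<close>

lemma symmetric_lower_bound:
  fixes S :: "('a::complex_inner \<times> 'a) set"
  assumes "S \<subseteq> radj S" "(f, z *\<^sub>C f + y) \<in> S"
  shows "\<bar>Im z\<bar> * norm f \<le> norm y"
proof -
  have "cinner (z *\<^sub>C f + y) f = cinner f (z *\<^sub>C f + y)" using assms radj_iff by blast
  then have "z * (norm f)\<^sup>2 - cnj z * (norm f)\<^sup>2 = cinner f y - cnj (cinner f y)"
    using cinner_commute[of y f] by (simp add: cinner_algebra cinner_self algebra_simps)
  then have "Im (z * (norm f)\<^sup>2 - cnj z * (norm f)\<^sup>2) = Im (cinner f y - cnj (cinner f y))" by simp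
  then have "Im z * (norm f)\<^sup>2 = Im (cinner f y)" by (simp add: Im_power2)
  then have "\<bar>Im z\<bar> * (norm f)\<^sup>2 \<le> norm f * norm y"
    using abs_Im_le_cmod[of "cinner f y"] cauchy_schwarz[of f y] by (metis abs_mult abs_power2 order_trans)
  then show ?thesis by (cases "norm f = 0") (auto simp: power2_eq_square mult_le_cancel_left mult.left_commute)
qed

lemma rselfadjointD: "rselfadjoint S \<Longrightarrow> S \<subseteq> radj S"
  unfolding rselfadjoint_def by (rule equalityD1)

lemma csub_rselfadjoint: "rselfadjoint S \<Longrightarrow> csub S"
proof -
  assume "rselfadjoint S"
  then have "S = radj S" unfolding rselfadjoint_def .
  then show "csub S" by (rule ssubst) (rule csub_radj)
qed

lemma closed_rselfadjoint: "rselfadjoint S \<Longrightarrow> closed S"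
proof -
  assume "rselfadjoint S"
  then have "S = radj S" unfolding rselfadjoint_def .
  then show "closed S" by (rule ssubst) (rule closed_radj)
qed

text \<open>The set \<open>N\<close> is the range of \<open>S - z\<close>. A vector \<open>k\<close>
  orthogonal to it gives \<open>(k, cnj z k)\<close> in the adjoint, hence in \<open>S\<close>, and
  so vanishes by the lower bound. The same bound, with closedness of \<open>S\<close>, passes from a
  dense range to the whole space.\<close>

lemma selfadjoint_surj:
  fixes S :: "('a::chilbert \<times> 'a) set"
  assumes S: "rselfadjoint S" and z: "Im z \<noteq> 0"
  shows "\<exists>f. (f, z *\<^sub>C f + y) \<in> S"
proof -
  have eq: "S = radj S" using S unfolding rselfadjoint_def .
  note cS = csub_rselfadjoint[OF S] closed_rselfadjoint[OF S]
  define N where "N = {y. \<exists>f. (f, z *\<^sub>C f + y) \<in> S}"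
  have "csub N"
    unfolding csub_def
  proof (intro conjI ballI allI)
    show "0 \<in> N" using csub_0[OF cS(1)] by (auto simp: N_def zero_prod_def intro!: exI[of _ 0])
  next
    fix x y assume "x \<in> N" "y \<in> N"
    then obtain f g where "(f, z *\<^sub>C f + x) \<in> S" "(g, z *\<^sub>C g + y) \<in> S" by (auto simp: N_def)
    from csub_add[OF cS(1) this] show "x + y \<in> N"
      by (auto simp: N_def scaleC_algebra algebra_simps intro!: exI[of _ "f + g"])
  next
    fix c x assume "x \<in> N"
    then obtain f where "(f, z *\<^sub>C f + x) \<in> S" by (auto simp: N_def)
    from csub_scaleC[OF cS(1) this, of c] show "c *\<^sub>C x \<in> N"
      by (auto simp: N_def scaleC_algebra mult.commute intro!: exI[of _ "c *\<^sub>C f"])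
  qed
  moreover have "k = 0" if k: "\<And>s. s \<in> N \<Longrightarrow> cinner s k = 0" for k
  proof -
    have "cinner f' k = cinner f (cnj z *\<^sub>C k)" if "(f, f') \<in> S" for f f'
    proof -
      have "f' - z *\<^sub>C f \<in> N" using that by (auto simp: N_def intro!: exI[of _ f])
      then have "cinner (f' - z *\<^sub>C f) k = 0" by (rule k)
      then show ?thesis by (simp add: cinner_algebra)
    qed
    then have "(k, cnj z *\<^sub>C k + 0) \<in> S" by (subst eq) (simp add: radj_iff)
    then have "\<bar>Im (cnj z)\<bar> * norm k \<le> norm (0::'a)" by (rule symmetric_lower_bound[OF rselfadjointD[OF S]])
    then show ?thesis using z by (simp add: mult_le_0_iff)
  qed
  ultimately have dense: "closure N = UNIV" by (rule dense_if_orthogonal)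
  obtain u where u: "\<forall>n. u n \<in> N" "u \<longlonglongrightarrow> y"
    using dense_sequence[OF dense] by blast
  then obtain f where f: "\<And>n. (f n, z *\<^sub>C f n + u n) \<in> S" unfolding N_def by (simp add: N_def) metis
  have lb: "\<bar>Im z\<bar> * dist (f m) (f n) \<le> dist (u m) (u n)" for m n
    unfolding dist_norm using csub_diff[OF cS(1) f f, of m n]
    by (intro symmetric_lower_bound[OF rselfadjointD[OF S]]) (simp add: scaleC_algebra algebra_simps)
  have "Cauchy f"
  proof (rule metric_CauchyI)
    fix e :: real assume "e > 0"
    then obtain M where "\<forall>m\<ge>M. \<forall>n\<ge>M. dist (u m) (u n) < \<bar>Im z\<bar> * e"
      using metric_CauchyD[OF LIMSEQ_imp_Cauchy[OF u(2)], of "\<bar>Im z\<bar> * e"] z by auto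
    then have "\<forall>m\<ge>M. \<forall>n\<ge>M. \<bar>Im z\<bar> * dist (f m) (f n) < \<bar>Im z\<bar> * e" using lb le_less_trans by blast
    then show "\<exists>M. \<forall>m\<ge>M. \<forall>n\<ge>M. dist (f m) (f n) < e" using z by auto
  qed
  then obtain l where l: "f \<longlonglongrightarrow> l" using Cauchy_convergent convergent_def by blast
  have "(\<lambda>n. (f n, z *\<^sub>C f n + u n)) \<longlonglongrightarrow> (l, z *\<^sub>C l + y)" by (intro tendsto_intros l u)
  then have "(l, z *\<^sub>C l + y) \<in> S" by (rule closed_sequentially[OF cS(2) f, rotated])
  then show ?thesis by blast
qed

section \<open>Resolvents \<open>(S - z)^-1\<close> of a selfadjoint relation\<close>

definition resolvent :: "('a::complex_inner \<times> 'a) set \<Rightarrow> complex \<Rightarrow> 'a \<Rightarrow> 'a" where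
  "resolvent S z y = (SOME f. (f, z *\<^sub>C f + y) \<in> S)"

context
  fixes S :: "('a::chilbert \<times> 'a) set" and z :: complex
  assumes S: "rselfadjoint S" and z: "Im z \<noteq> 0"
begin

lemma resolvent_mem: "(resolvent S z y, z *\<^sub>C resolvent S z y + y) \<in> S"
  unfolding resolvent_def by (rule someI_ex[OF selfadjoint_surj[OF S z]])

lemma resolvent_eqI: "(f, z *\<^sub>C f + y) \<in> S \<Longrightarrow> resolvent S z y = f"
proof -
  assume a: "(f, z *\<^sub>C f + y) \<in> S"
  note cS = csub_rselfadjoint[OF S]
  from csub_diff[OF cS resolvent_mem[of y] a]
  have "(resolvent S z y - f, z *\<^sub>C (resolvent S z y - f) + 0) \<in> S" by (simp add: scaleC_algebra)
  then have "\<bar>Im z\<bar> * norm (resolvent S z y - f) \<le> norm (0::'a)" by (rule symmetric_lower_bound[OF rselfadjointD[OF S]])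
  then show ?thesis using z by (simp add: mult_le_0_iff)
qed

lemma norm_resolvent_le: "norm (resolvent S z y) \<le> norm y * (1 / \<bar>Im z\<bar>)"
proof -
  have "\<bar>Im z\<bar> * norm (resolvent S z y) \<le> norm y"
    by (rule symmetric_lower_bound[OF rselfadjointD[OF S] resolvent_mem])
  then show ?thesis using z by (simp add: field_simps)
qed

lemma bclin_resolvent: "bclin (resolvent S z)"
proof -
  note cS = csub_rselfadjoint[OF S]
  show ?thesis
  proof (rule bclinI)
    show "resolvent S z (x + y) = resolvent S z x + resolvent S z y" for x y
      using csub_add[OF cS resolvent_mem resolvent_mem, of x y]
      by (intro resolvent_eqI) (simp add: scaleC_algebra algebra_simps)
    show "resolvent S z (c *\<^sub>C x) = c *\<^sub>C resolvent S z x" for c x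
      using csub_scaleC[OF cS resolvent_mem, of c x]
      by (intro resolvent_eqI) (simp add: scaleC_algebra mult.commute)
  qed (rule norm_resolvent_le)
qed

end

lemma resolvent_adj:
  fixes S :: "('a::chilbert \<times> 'a) set"
  assumes S: "rselfadjoint S" and z: "Im z \<noteq> 0"
  shows "cinner (resolvent S z x) y = cinner x (resolvent S (cnj z) y)"
proof -
  have z': "Im (cnj z) \<noteq> 0" using z by simp
  have "cinner (z *\<^sub>C resolvent S z x + x) (resolvent S (cnj z) y) =
      cinner (resolvent S z x) (cnj z *\<^sub>C resolvent S (cnj z) y + y)"
    using resolvent_mem[OF S z, of x] subsetD[OF rselfadjointD[OF S] resolvent_mem[OF S z', of y]]
    unfolding radj_iff by blast
  then show ?thesis by (simp add: cinner_algebra)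
qed

section \<open>Preimages and closures under bounded operators, and Green's identity on
  closures\<close>

lemma csub_vimage:
  assumes T: "bclin T" and S: "csub S" shows "csub (T -` S)"
  unfolding csub_def
  by (auto simp: bclin_zero[OF T] bclin_add[OF T] bclin_scaleC[OF T] intro: csub_0[OF S] csub_add[OF S] csub_scaleC[OF S])

lemma closed_bclin_vimage:
  assumes "bclin T" "closed S" shows "closed (T -` S)"
  using assms(2) bclin_continuous_on[OF assms(1) continuous_on_id] by (simp add: closed_vimage)

lemma closure_bclin_subset:
  assumes T: "bclin T" and sub: "\<And>s. s \<in> S \<Longrightarrow> T s \<in> U" and s: "s \<in> closure S"
  shows "T s \<in> closure U"
proof -
  have "S \<subseteq> T -` closure U" using sub closure_subset by blast
  then have "closure S \<subseteq> T -` closure U" by (intro closure_minimal closed_bclin_vimage[OF T] closed_closure)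
  then show ?thesis using s by blast
qed

lemma bclin_id: "bclin (\<lambda>x. x)"
  by (simp add: bclin_def bounded_linear_ident)

lemma bclin_fst: "bclin fst" and bclin_snd: "bclin snd"
  by (simp_all add: bclin_def bounded_linear_fst bounded_linear_snd scaleC_prod_def)

lemma bclin_Pair: "bclin S \<Longrightarrow> bclin T \<Longrightarrow> bclin (\<lambda>x. (S x, T x))"
  by (simp add: bclin_def bounded_linear_Pair)

lemma bclin_plus: "bclin S \<Longrightarrow> bclin T \<Longrightarrow> bclin (\<lambda>x. S x + T x)"
  by (simp add: bclin_def bounded_linear_add scaleC_add_right)

lemma bclin_minus: "bclin S \<Longrightarrow> bclin T \<Longrightarrow> bclin (\<lambda>x. S x - T x)"
  by (simp add: bclin_def bounded_linear_sub scaleC_diff_right)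

lemma bclin_const: "bclin (\<lambda>x. 0)"
  by (simp add: bclin_def)

lemma bclin_comp: "bclin S \<Longrightarrow> bclin T \<Longrightarrow> bclin (\<lambda>x. S (T x))"
  by (simp add: bclin_def bounded_linear_compose)

lemma bclin_scale: "bclin T \<Longrightarrow> bclin (\<lambda>x. c *\<^sub>C T x)"
  using bounded_linear_compose[OF bounded_bilinear.bounded_linear_right[OF bounded_bilinear_scaleC, of c], of T]
  by (simp add: bclin_def scaleC_scaleC mult.commute)

lemmas bclin_intros = bclin_id bclin_fst bclin_snd bclin_Pair bclin_plus bclin_minus bclin_const bclin_scale

lemma greenD:
  "green G \<Longrightarrow> ((f, f'), (h, h')) \<in> G \<Longrightarrow> ((g, g'), (k, k')) \<in> G \<Longrightarrow>
    cinner f' g - cinner f g' = cinner h' k - cinner h k'"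
  unfolding green_def by (auto split: prod.splits)

lemma green_closure:
  assumes "green G" shows "green (closure G)"
proof -
  have "cinner f' g - cinner f g' = cinner h' k - cinner h k'"
    if p: "((f, f'), (h, h')) \<in> closure G" and q: "((g, g'), (k, k')) \<in> closure G" for f f' h h' g g' k k'
  proof -
    define \<phi> where "\<phi> p q = cinner (snd (fst p)) (fst (fst q)) - cinner (fst (fst p)) (snd (fst q))
      - (cinner (snd (snd p)) (fst (snd q)) - cinner (fst (snd p)) (snd (snd q)))"
      for p q :: "('a \<times> 'a) \<times> 'b \<times> 'b"
    obtain u v where u: "\<forall>n. u n \<in> G" "u \<longlonglongrightarrow> ((f, f'), (h, h'))"
      and v: "\<forall>n. v n \<in> G" "v \<longlonglongrightarrow> ((g, g'), (k, k'))"
      using p q by (auto simp: closure_sequential)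
    have "(\<lambda>n. \<phi> (u n) (v n)) \<longlonglongrightarrow> \<phi> ((f, f'), (h, h')) ((g, g'), (k, k'))"
      unfolding \<phi>_def by (intro tendsto_intros u v)
    moreover have "\<phi> (u n) (v n) = 0" for n
    proof -
      obtain a a' b b' c c' d d' where e: "u n = ((a, a'), (b, b'))" "v n = ((c, c'), (d, d'))"
        by (metis prod.exhaust)
      show ?thesis unfolding \<phi>_def e using greenD[OF assms, of a a' b b' c c' d d'] u(1) v(1) e by (metis eq_iff_diff_eq_0 fst_conv snd_conv)
    qed
    ultimately have "\<phi> ((f, f'), (h, h')) ((g, g'), (k, k')) = 0" by (simp add: LIMSEQ_const_iff)
    then show ?thesis by (simp add: \<phi>_def)
  qed
  then show ?thesis unfolding green_def by (auto split: prod.splits)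
qed

lemma closure_mono_UNIV: "closure S = UNIV \<Longrightarrow> S \<subseteq> T \<Longrightarrow> closure T = UNIV"
  using closure_mono[of S T] by (simp add: top.extremum_unique)

section \<open>Unitary boundary triples with essentially selfadjoint kernel\<close>

locale ess_unitary_triple =
  fixes A :: "('a::chilbert \<times> 'a) set"
    and \<Gamma> :: "(('a \<times> 'a) \<times> ('b::chilbert \<times> 'b)) set"
  assumes ubt: "unitary_bt A \<Gamma>"
    and ess: "rselfadjoint (closure (rker (Gamma0 \<Gamma>)))"
begin

text \<open>The pointwise form of the unitarity condition: from left to right it is Green's
  identity, from right to left it is the maximality of \<open>\<Gamma>\<close> for that
  identity.\<close>

lemma mem_iff:
  "((g, g'), (k, k')) \<in> \<Gamma> \<longleftrightarrow>
    (\<forall>f f' h h'. ((f, f'), (h, h')) \<in> \<Gamma> \<longrightarrow> cinner f' g - cinner f g' = cinner h' k - cinner h k')"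
proof -
  have "((g, g'), (k, k')) \<in> \<Gamma> \<longleftrightarrow> ((k, k'), (g, g')) \<in> gamma_adj \<Gamma>"
    using ubt unfolding unitary_bt_def by (metis converse_iff)
  then show ?thesis unfolding gamma_adj_def by (auto split: prod.splits)
qed

lemma csub_Gamma: "csub \<Gamma>"
  using ubt by (simp add: unitary_bt_def clin_brel_iff_csub)

lemma mul_trivial: "((0, 0), (0, y)) \<in> \<Gamma> \<Longrightarrow> y = 0"
  using ubt by (auto simp: unitary_bt_def bmul_def)

text \<open>The relation \<open>S\<close> in the proof is the main transform of the boundary triple.\<close>

lemma main_transform_surj:
  assumes z: "Im z \<noteq> 0"
  shows "\<exists>f h. ((f, z *\<^sub>C f + x), (h, y - z *\<^sub>C h)) \<in> \<Gamma>"
proof -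
  define S where "S = {((g, k), (g', l)) | g k g' l. ((g, g'), (k, - l)) \<in> \<Gamma>}"
  have S: "((g, k), (g', l)) \<in> S \<longleftrightarrow> ((g, g'), (k, - l)) \<in> \<Gamma>" for g k g' l by (simp add: S_def)
  have "p \<in> S \<longleftrightarrow> p \<in> radj S" for p
  proof -
    obtain g k g' l where p: "p = ((g, k), (g', l))" by (metis prod.exhaust)
    have "p \<in> radj S \<longleftrightarrow> (\<forall>f h f' m. ((f, f'), (h, - m)) \<in> \<Gamma> \<longrightarrow>
        cinner f' g + cinner m k = cinner f g' + cinner h l)"
      unfolding p radj_iff by (simp add: split_paired_All S)
    also have "\<dots> \<longleftrightarrow> (\<forall>f f' h h'. ((f, f'), (h, h')) \<in> \<Gamma> \<longrightarrow>
        cinner f' g - cinner f g' = cinner h' k - cinner h (- l))"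
    proof (intro iffI allI impI)
      fix f f' h h' assume "\<forall>f h f' m. ((f, f'), (h, - m)) \<in> \<Gamma> \<longrightarrow>
        cinner f' g + cinner m k = cinner f g' + cinner h l" "((f, f'), (h, h')) \<in> \<Gamma>"
      then have "cinner f' g + cinner (- h') k = cinner f g' + cinner h l" by (metis minus_minus)
      then show "cinner f' g - cinner f g' = cinner h' k - cinner h (- l)" by (simp add: algebra_simps)
    next
      fix f h f' m assume "\<forall>f f' h h'. ((f, f'), (h, h')) \<in> \<Gamma> \<longrightarrow>
        cinner f' g - cinner f g' = cinner h' k - cinner h (- l)" "((f, f'), (h, - m)) \<in> \<Gamma>"
      then have "cinner f' g - cinner f g' = cinner (- m) k - cinner h (- l)" by blast
      then show "cinner f' g + cinner m k = cinner f g' + cinner h l" by (simp add: algebra_simps)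
    qed
    also have "\<dots> \<longleftrightarrow> p \<in> S" unfolding p S mem_iff[of g g' k "- l"] ..
    finally show ?thesis by blast
  qed
  then have "rselfadjoint S" unfolding rselfadjoint_def by blast
  \<comment> \<open>The sign of \<open>- y\<close> cancels the sign of \<open>- l\<close> in
    \<open>S\<close>, so that solving \<open>(S - z) p = (x, - y)\<close> is exactly the claim about
    \<open>\<Gamma>\<close>.\<close>
  from selfadjoint_surj[OF this z, of "(x, - y)"]
  obtain p where "(p, z *\<^sub>C p + (x, - y)) \<in> S" by blast
  moreover obtain f h where "p = (f, h)" by (metis prod.exhaust)
  ultimately show ?thesis by (auto simp: S)
qed

text \<open>Solving the main transform equation produces an element of \<open>\<Gamma>\<close> with some \<open>\<Gamma>\<^sub>0\<close>-component \<open>k\<close>;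
  Green's identity shows \<open>k \<bottom> ran (M(z) + z)\<close>, which is everything.\<close>

lemma gamma_adjoint:
  assumes z: "Im z \<noteq> 0" and H: "\<And>f h h'. ((f, z *\<^sub>C f), (h, h')) \<in> \<Gamma> \<Longrightarrow> cinner f u = cinner h v"
  shows "\<exists>g. ((g, cnj z *\<^sub>C g + u), (0, v)) \<in> \<Gamma>"
proof -
  have "Im (cnj z) \<noteq> 0" using z by simp
  from main_transform_surj[OF this]
  obtain g k where g: "((g, cnj z *\<^sub>C g + u), (k, v - cnj z *\<^sub>C k)) \<in> \<Gamma>" by blast
  obtain f h where f: "((f, z *\<^sub>C f), (h, k - z *\<^sub>C h)) \<in> \<Gamma>"
    using main_transform_surj[OF z, of 0 k] by auto
  have "cinner (z *\<^sub>C f) g - cinner f (cnj z *\<^sub>C g + u)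
      = cinner (k - z *\<^sub>C h) k - cinner h (v - cnj z *\<^sub>C k)"
    using g f unfolding mem_iff[of g] by blast
  then have "cinner k k = 0" using H[OF f] by (simp add: cinner_algebra)
  then have "k = 0" by (rule cinner_eq_zero)
  then show ?thesis using g by auto
qed

section \<open>The kernel of \<open>\<Gamma>\<^sub>0\<close>, the relation \<open>W\<close> and the
  closed gamma-field\<close>

definition A0 :: "('a \<times> 'a) set" where "A0 = rker (Gamma0 \<Gamma>)"

definition B :: "('a \<times> 'a) set" where "B = closure A0"

lemma A0_iff: "(g, g') \<in> A0 \<longleftrightarrow> (\<exists>k'. ((g, g'), (0, k')) \<in> \<Gamma>)"
  by (simp add: A0_def rker_def Gamma0_def)

lemma B_selfadjoint: "rselfadjoint B"
  using ess by (simp add: B_def A0_def)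

lemmas csub_B = csub_rselfadjoint[OF B_selfadjoint]

lemma B_eq_radj: "B = radj A0"
proof -
  have "B = radj B" using B_selfadjoint unfolding rselfadjoint_def .
  then show ?thesis unfolding B_def radj_closure .
qed

text \<open>The adjoint, in the sense of Green's identity, of \<open>\<Gamma>\<^sub>1\<close> restricted to \<open>ker \<Gamma>\<^sub>0\<close>: a description
  of all the closed \<open>\<gamma>\<close>-field values at once.\<close>

definition W :: "(('a \<times> 'a) \<times> 'b) set" where
  "W = (\<Inter>((g, g'), (k, k')) \<in> \<Gamma> \<inter> {p. fst (snd p) = 0}.
     {p. cinner (snd (fst p)) g - cinner (fst (fst p)) g' = - cinner (snd p) k'})"

lemma W_iff:
  "((f, f'), h) \<in> W \<longleftrightarrow> (\<forall>g g' k'. ((g, g'), (0, k')) \<in> \<Gamma> \<longrightarrow> cinner f' g - cinner f g' = - cinner h k')"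
  unfolding W_def by force

lemma closed_W: "closed W"
  unfolding W_def by (auto intro!: closed_INT closed_Collect_eq continuous_intros)

lemma W_add:
  assumes "((f, f'), h) \<in> W" "((g, g'), k) \<in> W" shows "((f + g, f' + g'), h + k) \<in> W"
  unfolding W_iff
proof (intro allI impI)
  fix p p' q assume "((p, p'), 0, q) \<in> \<Gamma>"
  then have "cinner f' p - cinner f p' = - cinner h q" "cinner g' p - cinner g p' = - cinner k q"
    using assms unfolding W_iff by blast+
  then show "cinner (f' + g') p - cinner (f + g) p' = - cinner (h + k) q"
    by (simp add: cinner_algebra algebra_simps)
qed

lemma W_scaleC:
  assumes "((f, f'), h) \<in> W" shows "((c *\<^sub>C f, c *\<^sub>C f'), c *\<^sub>C h) \<in> W"
  unfolding W_iff
proof (intro allI impI)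
  fix p p' q assume "((p, p'), 0, q) \<in> \<Gamma>"
  then have "cinner f' p - cinner f p' = - cinner h q" using assms unfolding W_iff by blast
  then have "c * (cinner f' p - cinner f p') = c * (- cinner h q)" by simp
  then show "cinner (c *\<^sub>C f') p - cinner (c *\<^sub>C f) p' = - cinner (c *\<^sub>C h) q"
    by (simp add: cinner_algebra algebra_simps)
qed

lemma W_diff:
  assumes "((f, f'), h) \<in> W" "((g, g'), k) \<in> W" shows "((f - g, f' - g'), h - k) \<in> W"
  using W_add[OF assms(1) W_scaleC[OF assms(2), of "-1"]] by simp

lemma Gamma_W: "((f, f'), (h, h')) \<in> \<Gamma> \<Longrightarrow> ((f, f'), h) \<in> W"
  unfolding W_iff
proof (intro allI impI)
  fix g g' k' assume a: "((f, f'), (h, h')) \<in> \<Gamma>" and b: "((g, g'), (0, k')) \<in> \<Gamma>"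
  have "cinner f' g - cinner f g' = cinner h' 0 - cinner h k'" using a b unfolding mem_iff[of g] by blast
  then show "cinner f' g - cinner f g' = - cinner h k'" by simp
qed

text \<open>With zero boundary component the condition in \<open>W\<close> describes the adjoint of
  \<open>A0\<close>; essential selfadjointness identifies this adjoint with the closure
  \<open>B\<close>.\<close>

lemma W_0_iff: "((f, f'), 0) \<in> W \<longleftrightarrow> (f, f') \<in> B"
proof -
  have "(cinner f' g - cinner f g' = 0) = (cinner g' f = cinner g f')" for g g'
    by (metis cinner_commute complex_cnj_cancel_iff eq_iff_diff_eq_0)
  then show ?thesis unfolding B_eq_radj radj_iff W_iff A0_iff by auto
qed

text \<open>A selfadjoint relation has no nonreal eigenvalue. Hence, for nonreal \<open>z\<close>,
  an element \<open>((f, z f), h)\<close> of \<open>W\<close> is determined by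
  \<open>h\<close>.\<close>

lemma W_eigen_0:
  assumes "Im z \<noteq> 0" "((f, z *\<^sub>C f), 0) \<in> W" shows "f = 0"
proof -
  have "(f, z *\<^sub>C f + 0) \<in> B" using assms(2) by (simp add: W_0_iff)
  from symmetric_lower_bound[OF rselfadjointD[OF B_selfadjoint] this]
  show ?thesis using assms(1) by (simp add: mult_le_0_iff)
qed

lemma csub_gamma_field: "csub (gamma_field \<Gamma> z)"
proof -
  have iff: "(h, f) \<in> gamma_field \<Gamma> z \<longleftrightarrow> (\<exists>h'. ((f, z *\<^sub>C f), (h, h')) \<in> \<Gamma>)" for h f
    by (simp add: gamma_field_def)
  have "(0, 0) \<in> gamma_field \<Gamma> z"
    unfolding iff using csub_0[OF csub_Gamma] by (auto simp: zero_prod_def)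
  moreover have "(h + k, f + g) \<in> gamma_field \<Gamma> z" if "(h, f) \<in> gamma_field \<Gamma> z" "(k, g) \<in> gamma_field \<Gamma> z" for h f k g
    using that csub_add[OF csub_Gamma, of "((f, z *\<^sub>C f), (h, _))" "((g, z *\<^sub>C g), (k, _))"]
    unfolding iff by (fastforce simp: scaleC_add_right)
  moreover have "(c *\<^sub>C h, c *\<^sub>C f) \<in> gamma_field \<Gamma> z" if "(h, f) \<in> gamma_field \<Gamma> z" for c h f
    using that csub_scaleC[OF csub_Gamma, of "((f, z *\<^sub>C f), (h, _))" c]
    unfolding iff by (fastforce simp: scaleC_scaleC mult.commute)
  ultimately show ?thesis unfolding csub_def by (auto simp: zero_prod_def)
qed

text \<open>One direction holds because \<open>W\<close> is closed. For the other, a pair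
  \<open>(a, b)\<close> orthogonal to the gamma-field yields, through \<open>gamma_adjoint\<close>,
  an element of \<open>\<Gamma>\<close> with vanishing \<open>\<Gamma>\<^sub>0\<close>-component;
  testing membership in \<open>W\<close> against it says precisely that \<open>(h, f)\<close> is
  orthogonal to \<open>(a, b)\<close>.\<close>

lemma closure_gamma_iff:
  assumes z: "Im z \<noteq> 0"
  shows "(h, f) \<in> closure (gamma_field \<Gamma> z) \<longleftrightarrow> ((f, z *\<^sub>C f), h) \<in> W"
proof
  have "gamma_field \<Gamma> z \<subseteq> (\<lambda>p. ((snd p, z *\<^sub>C snd p), fst p)) -` W"
    using Gamma_W by (auto simp: gamma_field_def)
  moreover have "closed ((\<lambda>p. ((snd p, z *\<^sub>C snd p), fst p)) -` W)"
    by (intro closed_bclin_vimage bclin_intros closed_W)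
  ultimately have "closure (gamma_field \<Gamma> z) \<subseteq> (\<lambda>p. ((snd p, z *\<^sub>C snd p), fst p)) -` W"
    by (rule closure_minimal)
  moreover assume "(h, f) \<in> closure (gamma_field \<Gamma> z)"
  ultimately show "((f, z *\<^sub>C f), h) \<in> W" by auto
next
  assume W: "((f, z *\<^sub>C f), h) \<in> W"
  show "(h, f) \<in> closure (gamma_field \<Gamma> z)"
  proof (rule in_closure_if_orthogonal[OF csub_gamma_field])
    fix y assume o: "\<And>s. s \<in> gamma_field \<Gamma> z \<Longrightarrow> cinner s y = 0"
    obtain a b where y: "y = (a, b)" by (metis prod.exhaust)
    have "\<exists>g. ((g, cnj z *\<^sub>C g + b), (0, - a)) \<in> \<Gamma>"
    proof (rule gamma_adjoint[OF z])
      fix f h h' assume "((f, z *\<^sub>C f), (h, h')) \<in> \<Gamma>"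
      then have "cinner (h, f) y = 0" by (intro o) (auto simp: gamma_field_def)
      then have "cinner h a + cinner f b = 0" by (simp add: y)
      then show "cinner f b = cinner h (- a)" by (metis add_eq_0_iff cinner_minus_right)
    qed
    then obtain g where "((g, cnj z *\<^sub>C g + b), (0, - a)) \<in> \<Gamma>" by blast
    then have "cinner (z *\<^sub>C f) g - cinner f (cnj z *\<^sub>C g + b) = - cinner h (- a)"
      using W unfolding W_iff by blast
    then have "cinner h a = - cinner f b" by (simp add: cinner_algebra)
    then show "cinner (h, f) y = 0" by (simp add: y)
  qed
qed

text \<open>Adding \<open>z - w\<close> times the element \<open>(R f, z R f + f)\<close> of
  \<open>B\<close>, with \<open>R\<close> the resolvent at \<open>z\<close>, changes the eigenvalue
  from \<open>w\<close> to \<open>z\<close> and leaves \<open>h\<close> untouched. This is why the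
  domain of the closed gamma-field does not depend on \<open>z\<close>.\<close>

lemma W_shift:
  assumes z: "Im z \<noteq> 0" and W: "((f, w *\<^sub>C f), h) \<in> W"
  shows "((f + (z - w) *\<^sub>C resolvent B z f, z *\<^sub>C (f + (z - w) *\<^sub>C resolvent B z f)), h) \<in> W"
proof -
  have "((resolvent B z f, z *\<^sub>C resolvent B z f + f), 0) \<in> W"
    unfolding W_0_iff by (rule resolvent_mem[OF B_selfadjoint z])
  from W_add[OF W W_scaleC[OF this, of "z - w"]]
  show ?thesis by (simp add: scaleC_algebra algebra_simps)
qed

text \<open>A vector \<open>y\<close> orthogonal to the domain produces
  \<open>((g, cnj z g), (0, y))\<close> in \<open>\<Gamma>\<close>. Absence of nonreal eigenvalues
  forces \<open>g = 0\<close>, and then \<open>y = 0\<close> because \<open>\<Gamma>\<close> is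
  single-valued.\<close>

lemma dense_dom_gamma:
  assumes z: "Im z \<noteq> 0"
  shows "closure (rdom (gamma_field \<Gamma> z)) = UNIV"
proof (rule dense_if_orthogonal)
  show "csub (rdom (gamma_field \<Gamma> z))"
    using csub_gamma_field[of z] unfolding csub_def rdom_def
    by (auto simp: zero_prod_def image_iff) (metis fst_conv add_Pair scaleC_Pair)+
  fix y assume o: "\<And>s. s \<in> rdom (gamma_field \<Gamma> z) \<Longrightarrow> cinner s y = 0"
  have "\<exists>g. ((g, cnj z *\<^sub>C g + 0), (0, y)) \<in> \<Gamma>"
  proof (rule gamma_adjoint[OF z])
    fix f h h' assume "((f, z *\<^sub>C f), (h, h')) \<in> \<Gamma>"
    then have "(h, f) \<in> gamma_field \<Gamma> z" by (auto simp: gamma_field_def)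
    then have "h \<in> rdom (gamma_field \<Gamma> z)" unfolding rdom_def by force
    then show "cinner f 0 = cinner h y" by (simp add: o)
  qed
  then obtain g where g: "((g, cnj z *\<^sub>C g), (0, y)) \<in> \<Gamma>" by auto
  have "g = 0" by (rule W_eigen_0[of "cnj z"]) (use z Gamma_W[OF g] in auto)
  then show "y = 0" using g mul_trivial by simp
qed

lemma gamma_factorization:
  "\<exists>G K. bclin G \<and> bclin K \<and> is_adj G G \<and> (\<forall>x. G x = 0 \<longrightarrow> x = 0)
    \<and> closure (gamma_field \<Gamma> \<i>) = range (\<lambda>x. (G x, K x)) \<and> (\<forall>x. norm (G x, K x) = norm x)"
proof (rule closed_operator_factorization)
  show "csub (closure (gamma_field \<Gamma> \<i>))" by (intro csub_closure csub_gamma_field)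
  show "f = 0" if "(0, f) \<in> closure (gamma_field \<Gamma> \<i>)" for f
    using that W_eigen_0[of \<i> f] by (simp add: closure_gamma_iff)
  have "rdom (gamma_field \<Gamma> \<i>) \<subseteq> rdom (closure (gamma_field \<Gamma> \<i>))"
    unfolding rdom_def by (intro image_mono closure_subset)
  then have "closure (rdom (gamma_field \<Gamma> \<i>)) \<subseteq> closure (rdom (closure (gamma_field \<Gamma> \<i>)))"
    by (rule closure_mono)
  then show "closure (rdom (closure (gamma_field \<Gamma> \<i>))) = UNIV"
    using dense_dom_gamma[of \<i>] by (simp add: top.extremum_unique)
qed simp

end

section \<open>Factorization of the closed gamma-field at \<open>\<i>\<close> and its values
  elsewhere\<close>

locale factorized_triple = ess_unitary_triple A \<Gamma>
  for A :: "('a::chilbert \<times> 'a) set" and \<Gamma> :: "(('a \<times> 'a) \<times> ('b::chilbert \<times> 'b)) set" +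
  fixes G :: "'b \<Rightarrow> 'b" and K :: "'b \<Rightarrow> 'a" and Ks :: "'a \<Rightarrow> 'b"
  assumes G: "bclin G" "is_adj G G" "\<And>x. G x = 0 \<Longrightarrow> x = 0"
    and K: "bclin K" and Ks: "bclin Ks" and K_adj: "is_adj K Ks"
    and factor: "closure (gamma_field \<Gamma> \<i>) = range (\<lambda>x. (G x, K x))"
    and iso: "\<And>x. norm (G x, K x) = norm x"
begin

lemma G_adj: "cinner (G x) y = cinner x (G y)"
  using G(2) unfolding is_adj_def by blast

lemma K_Ks: "cinner (K x) y = cinner x (Ks y)"
  using K_adj unfolding is_adj_def by blast

lemma Ks_K: "cinner (Ks y) x = cinner y (K x)"
  using K_Ks[of x y] cinner_commute[of "Ks y" x] cinner_commute[of y "K x"] by simp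

lemma norm_sq_GK: "(norm x)\<^sup>2 = (norm (G x))\<^sup>2 + (norm (K x))\<^sup>2"
  by (simp only: iso[of x, symmetric] norm_Pair real_sqrt_pow2 sum_power2_ge_zero)

definition R :: "complex \<Rightarrow> 'a \<Rightarrow> 'a" where "R z = resolvent B z"

lemma R_mem: "Im z \<noteq> 0 \<Longrightarrow> (R z y, z *\<^sub>C R z y + y) \<in> B"
  unfolding R_def by (rule resolvent_mem[OF B_selfadjoint])

lemma bclin_R: "Im z \<noteq> 0 \<Longrightarrow> bclin (R z)"
  unfolding R_def by (rule bclin_resolvent[OF B_selfadjoint])

lemma R_adj: "Im z \<noteq> 0 \<Longrightarrow> cinner (R z x) y = cinner x (R (cnj z) y)"
  unfolding R_def by (rule resolvent_adj[OF B_selfadjoint])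

lemma norm_R_le: "Im z \<noteq> 0 \<Longrightarrow> norm (R z y) \<le> norm y * (1 / \<bar>Im z\<bar>)"
  unfolding R_def by (rule norm_resolvent_le[OF B_selfadjoint])

lemma resolvent_identity:
  assumes "Im z \<noteq> 0" "Im w \<noteq> 0"
  shows "(w - z) *\<^sub>C R z (R w y) = R w y - R z y"
proof -
  have "R z ((w - z) *\<^sub>C R w y) = R w y - R z y"
    unfolding R_def
  proof (rule resolvent_eqI[OF B_selfadjoint assms(1)])
    show "(resolvent B w y - resolvent B z y,
        z *\<^sub>C (resolvent B w y - resolvent B z y) + (w - z) *\<^sub>C resolvent B w y) \<in> B"
      using csub_diff[OF csub_B resolvent_mem[OF B_selfadjoint assms(2), of y]
          resolvent_mem[OF B_selfadjoint assms(1), of y]]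
      by (simp add: scaleC_algebra algebra_simps)
  qed
  then show ?thesis by (simp add: bclin_scaleC[OF bclin_R[OF assms(1)]])
qed

text \<open>The closed gamma-field at \<open>z\<close>, composed with \<open>G\<close>; at
  \<open>\<i>\<close> it is \<open>K\<close>. The formula is the one produced by
  \<open>W_shift\<close>.\<close>

definition Kz :: "complex \<Rightarrow> 'b \<Rightarrow> 'a" where
  "Kz z x = K x + (z - \<i>) *\<^sub>C R z (K x)"

lemma bclin_Kz: "Im z \<noteq> 0 \<Longrightarrow> bclin (Kz z)"
  unfolding Kz_def by (rule bclin_plus[OF K bclin_scale[OF bclin_comp[OF bclin_R K]]])

lemma K_W: "((K x, \<i> *\<^sub>C K x), G x) \<in> W"
proof -
  have "(G x, K x) \<in> closure (gamma_field \<Gamma> \<i>)" unfolding factor by blast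
  then show ?thesis by (simp add: closure_gamma_iff)
qed

lemma Kz_W: "Im z \<noteq> 0 \<Longrightarrow> ((Kz z x, z *\<^sub>C Kz z x), G x) \<in> W"
  using W_shift[OF _ K_W] by (simp add: Kz_def R_def)

lemma Kz_unique:
  assumes "Im z \<noteq> 0" "((f, z *\<^sub>C f), G x) \<in> W" shows "f = Kz z x"
  using W_eigen_0[OF assms(1), of "f - Kz z x"] W_diff[OF assms(2) Kz_W[OF assms(1), of x]]
  by (simp add: scaleC_diff_right)

lemma W_eigen_range:
  assumes "Im z \<noteq> 0" "((f, z *\<^sub>C f), h) \<in> W" shows "h \<in> range G"
proof -
  obtain g where "((g, \<i> *\<^sub>C g), h) \<in> W" using W_shift[OF _ assms(2), of \<i>] by auto
  then have "(h, g) \<in> closure (gamma_field \<Gamma> \<i>)" by (simp add: closure_gamma_iff)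
  then show ?thesis unfolding factor by auto
qed

lemma Kz_shift:
  assumes "Im z \<noteq> 0" "Im w \<noteq> 0"
  shows "Kz w x = Kz z x + (w - z) *\<^sub>C R w (Kz z x)"
  using Kz_unique[OF assms(2) W_shift[OF assms(2) Kz_W[OF assms(1)]]] by (simp add: R_def)

lemma Kz_i: "Kz \<i> x = K x"
  by (simp add: Kz_def)

lemma dom_closure_gamma:
  assumes z: "Im z \<noteq> 0" shows "rdom (closure (gamma_field \<Gamma> z)) = range G"
proof
  show "rdom (closure (gamma_field \<Gamma> z)) \<subseteq> range G"
    using W_eigen_range[OF z] by (auto simp: rdom_def closure_gamma_iff[OF z])
  show "range G \<subseteq> rdom (closure (gamma_field \<Gamma> z))"
  proof
    fix h assume "h \<in> range G"
    then obtain x where "h = G x" by blast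
    then have "(h, Kz z x) \<in> closure (gamma_field \<Gamma> z)" using Kz_W[OF z] by (simp add: closure_gamma_iff[OF z])
    then show "h \<in> rdom (closure (gamma_field \<Gamma> z))" unfolding rdom_def by force
  qed
qed

section \<open>The transformed triple and its closure as an AB-generalized boundary pair\<close>

definition \<Gamma>G :: "(('a \<times> 'a) \<times> ('b \<times> 'b)) set" where "\<Gamma>G = transformed \<Gamma> G G"

definition \<Gamma>t :: "(('a \<times> 'a) \<times> ('b \<times> 'b)) set" where "\<Gamma>t = closure \<Gamma>G"

lemma GammaG_iff: "(p, (x, x')) \<in> \<Gamma>G \<longleftrightarrow> (\<exists>h'. (p, (G x, h')) \<in> \<Gamma> \<and> x' = G h')"
  by (cases p) (auto simp: \<Gamma>G_def transformed_def)

lemma GammaG_subset: "\<Gamma>G \<subseteq> \<Gamma>t" unfolding \<Gamma>t_def by (rule closure_subset)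

lemma csub_GammaG: "csub \<Gamma>G"
  unfolding csub_def
proof (intro conjI ballI allI)
  show "0 \<in> \<Gamma>G"
    using csub_0[OF csub_Gamma] by (force simp: zero_prod_def GammaG_iff bclin_zero[OF G(1)])
  show "p + q \<in> \<Gamma>G" if pq: "p \<in> \<Gamma>G" "q \<in> \<Gamma>G" for p q
  proof -
    obtain f x x' g y y' where e: "p = (f, (x, x'))" "q = (g, (y, y'))" by (metis prod.exhaust)
    obtain h where "(f, (G x, h)) \<in> \<Gamma>" "x' = G h" using pq(1) unfolding e GammaG_iff by blast
    moreover obtain h' where "(g, (G y, h')) \<in> \<Gamma>" "y' = G h'" using pq(2) unfolding e GammaG_iff by blast
    ultimately show ?thesis using csub_add[OF csub_Gamma, of "(f, (G x, h))" "(g, (G y, h'))"]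
      by (auto simp: e GammaG_iff bclin_add[OF G(1)])
  qed
  show "c *\<^sub>C p \<in> \<Gamma>G" if p: "p \<in> \<Gamma>G" for c p
  proof -
    obtain f x x' where e: "p = (f, (x, x'))" by (metis prod.exhaust)
    obtain h where "(f, (G x, h)) \<in> \<Gamma>" "x' = G h" using p unfolding e GammaG_iff by blast
    then show ?thesis using csub_scaleC[OF csub_Gamma, of "(f, (G x, h))" c]
      by (auto simp: e GammaG_iff bclin_scaleC[OF G(1)])
  qed
qed

lemma csub_Gammat: "csub \<Gamma>t" unfolding \<Gamma>t_def by (rule csub_closure[OF csub_GammaG])

lemma closed_Gammat: "closed \<Gamma>t" unfolding \<Gamma>t_def by (rule closed_closure)

lemma green_Gammat: "green \<Gamma>t"
  unfolding \<Gamma>t_def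
proof (rule green_closure)
  have "cinner f' g - cinner f g' = cinner x' y - cinner x y'"
    if p: "((f, f'), (x, x')) \<in> \<Gamma>G" and q: "((g, g'), (y, y')) \<in> \<Gamma>G" for f f' x x' g g' y y'
  proof -
    obtain h k where h: "((f, f'), (G x, h)) \<in> \<Gamma>" "x' = G h" and k: "((g, g'), (G y, k)) \<in> \<Gamma>" "y' = G k"
      using p q unfolding GammaG_iff by blast
    have "cinner f' g - cinner f g' = cinner h (G y) - cinner (G x) k"
      using h(1) k(1) unfolding mem_iff[of g] by blast
    then show ?thesis by (simp add: h(2) k(2) G_adj)
  qed
  then show "green \<Gamma>G" unfolding green_def by (auto split: prod.splits)
qed

lemmas Gammat_green = greenD[OF green_Gammat]

text \<open>The part of Green's identity that survives the closure because \<open>W\<close> is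
  closed and \<open>G\<close> is bounded. It controls both the kernel and the eigenvectors of
  \<open>\<Gamma>t\<close>.\<close>

lemma Gammat_W:
  assumes "((f, f'), (x, x')) \<in> \<Gamma>t" shows "((f, f'), G x) \<in> W"
proof -
  have "\<Gamma>G \<subseteq> (\<lambda>p. (fst p, G (fst (snd p)))) -` W"
    using Gamma_W by (force simp: GammaG_iff)
  moreover have "closed ((\<lambda>p::('a \<times> 'a) \<times> ('b \<times> 'b). (fst p, G (fst (snd p)))) -` W)"
    by (rule closed_bclin_vimage[OF bclin_Pair[OF bclin_fst bclin_comp[OF G(1) bclin_comp[OF bclin_fst bclin_snd]]] closed_W])
  ultimately have "\<Gamma>t \<subseteq> (\<lambda>p. (fst p, G (fst (snd p)))) -` W"
    unfolding \<Gamma>t_def by (rule closure_minimal)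
  then show ?thesis using assms by force
qed

text \<open>For an element of \<open>A0\<close> with boundary value \<open>(0, k)\<close>, testing
  the points \<open>((K x, \<i> K x), G x)\<close> of \<open>W\<close> against it identifies
  \<open>G k\<close> with \<open>Ks (g' + \<i> g)\<close>. The right-hand side is bounded in
  \<open>(g, g')\<close>, so the description extends from \<open>A0\<close> to its closure
  \<open>B\<close>.\<close>

lemma B_Gammat:
  assumes "(b, b') \<in> B" shows "((b, b'), (0, Ks (b' + \<i> *\<^sub>C b))) \<in> \<Gamma>t"
proof -
  define T where "T p = (p, (0::'b, Ks (snd p + \<i> *\<^sub>C fst p)))" for p :: "'a \<times> 'a"
  have "bclin T" unfolding T_def by (intro bclin_intros bclin_comp[OF Ks])
  moreover have "T s \<in> \<Gamma>G" if s: "s \<in> A0" for s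
  proof -
    obtain g g' where e: "s = (g, g')" by (metis prod.exhaust)
    obtain k where k: "((g, g'), (0, k)) \<in> \<Gamma>" using s unfolding e A0_iff by blast
    have "cinner x (G k) = cinner x (Ks (g' + \<i> *\<^sub>C g))" for x
    proof -
      have "cinner (\<i> *\<^sub>C K x) g - cinner (K x) g' = - cinner (G x) k"
        using K_W k unfolding W_iff by blast
      then have "cinner (K x) (g' + \<i> *\<^sub>C g) = cinner (G x) k" by (simp add: cinner_algebra algebra_simps)
      then show ?thesis by (simp add: K_Ks G_adj)
    qed
    then have "Ks (g' + \<i> *\<^sub>C g) = G k" by (metis eq_if_cinner_left)
    then show ?thesis using k by (auto simp: T_def e GammaG_iff bclin_zero[OF G(1)])
  qed
  moreover have "(b, b') \<in> closure A0" using assms by (simp add: B_def)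
  ultimately have "T (b, b') \<in> closure \<Gamma>G" by (rule closure_bclin_subset)
  then show ?thesis by (simp add: T_def \<Gamma>t_def)
qed

lemma Gammat_ker: "rker (Gamma0 \<Gamma>t) = B"
proof
  show "B \<subseteq> rker (Gamma0 \<Gamma>t)" using B_Gammat by (force simp: rker_def Gamma0_def)
  show "rker (Gamma0 \<Gamma>t) \<subseteq> B"
  proof (rule subrelI)
    fix f f' assume "(f, f') \<in> rker (Gamma0 \<Gamma>t)"
    then obtain x' where "((f, f'), (0, x')) \<in> \<Gamma>t" by (auto simp: rker_def Gamma0_def)
    from Gammat_W[OF this] show "(f, f') \<in> B" by (simp add: bclin_zero[OF G(1)] W_0_iff)
  qed
qed

text \<open>The value \<open>\<Gamma>\<^sub>0\<close> of an eigenvector in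
  \<open>dom \<Gamma>\<close> automatically lies in the range of \<open>G\<close>, so restricting to
  that range in the transformed triple loses no eigenvectors.\<close>

lemma gamma_field_range:
  assumes z: "Im z \<noteq> 0" and f: "((f, z *\<^sub>C f), (h, h')) \<in> \<Gamma>"
  shows "\<exists>x. h = G x \<and> f = Kz z x \<and> ((f, z *\<^sub>C f), (x, G h')) \<in> \<Gamma>G"
proof -
  obtain x where x: "h = G x" using W_eigen_range[OF z Gamma_W[OF f]] by blast
  then show ?thesis using Kz_unique[OF z, of f x] Gamma_W[OF f] f by (auto simp: GammaG_iff)
qed

text \<open>The isometry \<open>x \<mapsto> (G x, K x)\<close> carries the density of the
  gamma-field in its closure back to density of the parameters \<open>x\<close>.\<close>

lemma core_dense: "closure {x. \<exists>x'. ((K x, \<i> *\<^sub>C K x), (x, x')) \<in> \<Gamma>G} = UNIV"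
proof (rule UNIV_eq_I[symmetric])
  fix x
  show "x \<in> closure {x. \<exists>x'. ((K x, \<i> *\<^sub>C K x), (x, x')) \<in> \<Gamma>G}"
    unfolding closure_approachable
  proof (intro allI impI)
    fix e :: real assume "e > 0"
    moreover have "(G x, K x) \<in> closure (gamma_field \<Gamma> \<i>)" unfolding factor by blast
    ultimately obtain p where p: "p \<in> gamma_field \<Gamma> \<i>" "dist p (G x, K x) < e"
      unfolding closure_approachable by blast
    obtain h f where hf: "p = (h, f)" by (metis prod.exhaust)
    obtain h' where "((f, \<i> *\<^sub>C f), (h, h')) \<in> \<Gamma>" using p(1) by (auto simp: hf gamma_field_def)
    from gamma_field_range[OF _ this] obtain y where
      y: "h = G y" "f = K y" "((f, \<i> *\<^sub>C f), (y, G h')) \<in> \<Gamma>G" by (auto simp: Kz_i)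
    have "dist p (G x, K x) = dist y x"
      using iso[of "y - x"] by (simp add: hf y(1,2) dist_norm bclin_diff[OF G(1)] bclin_diff[OF K])
    then show "\<exists>y\<in>{x. \<exists>x'. ((K x, \<i> *\<^sub>C K x), (x, x')) \<in> \<Gamma>G}. dist y x < e"
      using p(2) y by auto
  qed
qed

lemma Gammat_ran_dense: "closure (rran (Gamma0 \<Gamma>t)) = UNIV"
  by (rule closure_mono_UNIV[OF core_dense])
    (use GammaG_subset in \<open>force simp: rran_def Gamma0_def\<close>)

lemma GammaG_dom: "rdom \<Gamma>G \<subseteq> radj A"
proof -
  have "rdom \<Gamma>G \<subseteq> rdom \<Gamma>" by (force simp: rdom_def GammaG_iff)
  then show ?thesis using ubt by (auto simp: unitary_bt_def)
qed

lemma Gammat_dom: "rdom \<Gamma>t \<subseteq> radj A"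
proof -
  have "\<Gamma>G \<subseteq> fst -` radj A" using GammaG_dom by (auto simp: rdom_def)
  then have "\<Gamma>t \<subseteq> fst -` radj A"
    unfolding \<Gamma>t_def by (intro closure_minimal closed_bclin_vimage bclin_fst closed_radj)
  then show ?thesis by (auto simp: rdom_def)
qed

lemma csub_rdom_GammaG: "csub (rdom \<Gamma>G)"
  unfolding csub_def rdom_def
proof (intro conjI ballI allI)
  show "0 \<in> fst ` \<Gamma>G" using csub_0[OF csub_GammaG] by (metis fst_zero imageI)
  show "p + q \<in> fst ` \<Gamma>G" if "p \<in> fst ` \<Gamma>G" "q \<in> fst ` \<Gamma>G" for p q
    using that csub_add[OF csub_GammaG] by (metis (no_types, lifting) fst_add image_iff)
  show "c *\<^sub>C p \<in> fst ` \<Gamma>G" if "p \<in> fst ` \<Gamma>G" for c p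
    using that csub_scaleC[OF csub_GammaG] by (force simp: scaleC_prod_def image_iff)
qed

text \<open>Since \<open>B - \<i>\<close> is onto, an element of the adjoint of \<open>A\<close>
  splits into an element of \<open>B\<close> and a defect pair \<open>(n, \<i> n)\<close>. The first
  part is approximated from \<open>A0\<close>; the second is handled by an orthogonality argument in
  the defect vectors.\<close>

lemma Gammat_dom_dense: "radj A \<subseteq> closure (rdom \<Gamma>t)"
proof (rule subrelI)
  fix f f' assume f: "(f, f') \<in> radj A"
  have A0_dom: "A0 \<subseteq> rdom \<Gamma>G"
  proof (rule subrelI)
    fix g g' assume "(g, g') \<in> A0"
    then obtain k where "((g, g'), (0, k)) \<in> \<Gamma>" unfolding A0_iff by blast
    then have "((g, g'), (0, G k)) \<in> \<Gamma>G" by (auto simp: GammaG_iff bclin_zero[OF G(1)])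
    then show "(g, g') \<in> rdom \<Gamma>G" unfolding rdom_def by force
  qed
  have B_dom: "B \<subseteq> closure (rdom \<Gamma>G)" unfolding B_def by (rule closure_mono[OF A0_dom])
  have B_adj: "B \<subseteq> radj A" unfolding B_def
    by (rule closure_minimal[OF order.trans[OF A0_dom GammaG_dom] closed_radj])
  define b where "b = R \<i> (f' - \<i> *\<^sub>C f)"
  have b: "(b, \<i> *\<^sub>C b + (f' - \<i> *\<^sub>C f)) \<in> B" unfolding b_def by (rule R_mem) simp
  define n where "n = f - b"
  have e: "(f, f') = (b, \<i> *\<^sub>C b + (f' - \<i> *\<^sub>C f)) + (n, \<i> *\<^sub>C n)"
    by (simp add: n_def scaleC_diff_right)
  have n: "(n, \<i> *\<^sub>C n) \<in> radj A"
    using csub_diff[OF csub_radj f subsetD[OF B_adj b]] by (simp add: n_def scaleC_algebra)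
  define T where "T g = (g, \<i> *\<^sub>C g)" for g :: 'a
  have T: "bclin T" unfolding T_def by (intro bclin_intros)
  have "n \<in> closure (T -` rdom \<Gamma>G)"
  proof (rule in_closure_if_orthogonal[OF csub_vimage[OF T csub_rdom_GammaG]])
    fix y assume o: "\<And>s. s \<in> T -` rdom \<Gamma>G \<Longrightarrow> cinner s y = 0"
    \<comment> \<open>An element of \<open>\<Gamma>\<close> with both boundary values zero: Green's
      form against it vanishes on \<open>dom \<Gamma>\<close>, hence by continuity on the whole
      adjoint of \<open>A\<close>, in particular at \<open>(n, \<i> n)\<close>.\<close>
    have "\<exists>g. ((g, cnj \<i> *\<^sub>C g + y), (0, 0)) \<in> \<Gamma>"
    proof (rule gamma_adjoint)
      fix g h h' assume "((g, \<i> *\<^sub>C g), (h, h')) \<in> \<Gamma>"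
      from gamma_field_range[OF _ this] obtain x where "((g, \<i> *\<^sub>C g), (x, G h')) \<in> \<Gamma>G" by auto
      then have "g \<in> T -` rdom \<Gamma>G" unfolding T_def rdom_def by force
      then show "cinner g y = cinner h 0" by (simp add: o)
    qed simp
    then obtain g where g: "((g, cnj \<i> *\<^sub>C g + y), (0, 0)) \<in> \<Gamma>" by blast
    have "rdom \<Gamma> \<subseteq> {p. cinner (snd p) g - cinner (fst p) (cnj \<i> *\<^sub>C g + y) = 0}"
    proof (rule subsetI)
      fix p assume "p \<in> rdom \<Gamma>"
      then obtain q q' h h' where p: "p = (q, q')" "((q, q'), (h, h')) \<in> \<Gamma>" by (auto simp: rdom_def)
      have "cinner q' g - cinner q (cnj \<i> *\<^sub>C g + y) = cinner h' 0 - cinner h 0"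
        using p(2) g unfolding mem_iff[of g] by blast
      then show "p \<in> {p. cinner (snd p) g - cinner (fst p) (cnj \<i> *\<^sub>C g + y) = 0}" by (simp add: p(1))
    qed
    then have "closure (rdom \<Gamma>) \<subseteq> {p. cinner (snd p) g - cinner (fst p) (cnj \<i> *\<^sub>C g + y) = 0}"
      by (rule closure_minimal) (intro closed_Collect_eq continuous_intros)
    moreover have "radj A \<subseteq> closure (rdom \<Gamma>)" using ubt by (simp add: unitary_bt_def)
    ultimately have "cinner (\<i> *\<^sub>C n) g - cinner n (cnj \<i> *\<^sub>C g + y) = 0" using n by auto
    then show "cinner n y = 0" by (simp add: cinner_algebra)
  qed
  then have "T n \<in> closure (rdom \<Gamma>G)" by (rule closure_bclin_subset[OF T, rotated]) simp
  then have "(f, f') \<in> closure (rdom \<Gamma>G)"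
    unfolding e using b B_dom by (intro csub_add[OF csub_closure[OF csub_rdom_GammaG]]) (auto simp: T_def)
  moreover have "rdom \<Gamma>G \<subseteq> rdom \<Gamma>t" unfolding rdom_def by (rule image_mono[OF GammaG_subset])
  ultimately show "(f, f') \<in> closure (rdom \<Gamma>t)" using closure_mono by blast
qed

lemma AB_Gammat: "AB_pair A \<Gamma>t"
  unfolding AB_pair_def clin_brel_iff_csub Gammat_ker
  using csub_Gammat Gammat_dom Gammat_dom_dense green_Gammat Gammat_ran_dense B_selfadjoint by blast

lemma Gammat_mul: "((0, 0), (0, y)) \<in> \<Gamma>t \<Longrightarrow> y = 0"
proof (rule orthogonal_dense_eq_0[OF Gammat_ran_dense])
  fix s assume y: "((0, 0), (0, y)) \<in> \<Gamma>t" and "s \<in> rran (Gamma0 \<Gamma>t)"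
  then obtain f f' s' where "((f, f'), (s, s')) \<in> \<Gamma>t" by (auto simp: rran_def Gamma0_def)
  from Gammat_green[OF this y] show "cinner s y = 0" by simp
qed

lemma weyl_Gammat_iff:
  assumes z: "Im z \<noteq> 0"
  shows "(x, x') \<in> weyl \<Gamma>t z \<longleftrightarrow> ((Kz z x, z *\<^sub>C Kz z x), (x, x')) \<in> \<Gamma>t"
proof -
  have "f = Kz z x" if "((f, z *\<^sub>C f), (x, x')) \<in> \<Gamma>t" for f
    by (rule Kz_unique[OF z Gammat_W[OF that]])
  then show ?thesis by (auto simp: weyl_def)
qed

section \<open>The Weyl family as a fixed symmetric operator plus a bounded function\<close>

definition F :: "complex \<Rightarrow> 'b \<Rightarrow> 'b" where
  "F z x = Ks (z *\<^sub>C K x + (z\<^sup>2 + 1) *\<^sub>C R z (K x))"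

text \<open>At \<open>\<i>\<close> the factor \<open>z^2 + 1\<close> vanishes, so the subtracted
  term \<open>\<i> Ks (K x)\<close> is \<open>F \<i> x\<close>. Writing the relation as a preimage
  of \<open>\<Gamma>t\<close> under a bounded operator makes linearity and closedness
  immediate.\<close>

definition E :: "('b \<times> 'b) set" where
  "E = (\<lambda>p. ((K (fst p), \<i> *\<^sub>C K (fst p)), (fst p, snd p + \<i> *\<^sub>C Ks (K (fst p))))) -` \<Gamma>t"

lemma E_iff: "(x, y) \<in> E \<longleftrightarrow> ((K x, \<i> *\<^sub>C K x), (x, y + \<i> *\<^sub>C Ks (K x))) \<in> \<Gamma>t"
  by (simp add: E_def)

lemma bclin_E_map: "bclin (\<lambda>p. ((K (fst p), \<i> *\<^sub>C K (fst p)), (fst p, snd p + \<i> *\<^sub>C Ks (K (fst p)))))"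
proof -
  have k: "bclin (\<lambda>p::'b \<times> 'b. K (fst p))" by (rule bclin_comp[OF K bclin_fst])
  show ?thesis by (rule bclin_Pair[OF bclin_Pair[OF k bclin_scale[OF k]]
    bclin_Pair[OF bclin_fst bclin_plus[OF bclin_snd bclin_scale[OF bclin_comp[OF Ks k]]]]])
qed

lemma Gammat_add_B:
  assumes "((f, f'), (x, x')) \<in> \<Gamma>t" "(b, b') \<in> B"
  shows "((f + b, f' + b'), (x, x' + Ks (b' + \<i> *\<^sub>C b))) \<in> \<Gamma>t"
  using csub_add[OF csub_Gammat assms(1) B_Gammat[OF assms(2)]] by simp

text \<open>The element \<open>(b, b')\<close> of \<open>B\<close> moves the eigenvalue from
  \<open>\<i>\<close> to \<open>z\<close>, keeps \<open>x\<close>, and by \<open>B_Gammat\<close>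
  adds \<open>Ks (b' + \<i> b)\<close>, which is \<open>F z x - F \<i> x\<close>. Subtracting it
  again gives the converse, so one \<open>E\<close> serves every nonreal \<open>z\<close>.\<close>

lemma Gammat_shift:
  assumes z: "Im z \<noteq> 0"
  shows "((Kz z x, z *\<^sub>C Kz z x), (x, y + F z x)) \<in> \<Gamma>t \<longleftrightarrow> (x, y) \<in> E"
proof -
  define b where "b = (z - \<i>) *\<^sub>C R z (K x)"
  define b' where "b' = (z - \<i>) *\<^sub>C (z *\<^sub>C R z (K x) + K x)"
  have b: "(b, b') \<in> B"
    using csub_scaleC[OF csub_B R_mem[OF z, of "K x"], of "z - \<i>"] by (simp add: b_def b'_def)
  then have b_neg: "(- b, - b') \<in> B" using csub_scaleC[OF csub_B b, of "-1"] by simp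
  have e1: "K x + b = Kz z x" by (simp add: b_def Kz_def)
  have e2: "\<i> *\<^sub>C K x + b' = z *\<^sub>C Kz z x"
    by (simp add: b'_def Kz_def scaleC_algebra algebra_simps)
  have "\<i> *\<^sub>C K x + (b' + \<i> *\<^sub>C b) = z *\<^sub>C K x + (z\<^sup>2 + 1) *\<^sub>C R z (K x)"
    by (simp add: b_def b'_def scaleC_algebra algebra_simps power2_eq_square)
  then have e3: "F z x = \<i> *\<^sub>C Ks (K x) + Ks (b' + \<i> *\<^sub>C b)"
    unfolding F_def by (metis bclin_add[OF Ks] bclin_scaleC[OF Ks])
  show ?thesis
  proof
    assume "(x, y) \<in> E"
    from Gammat_add_B[OF this[unfolded E_iff] b]
    show "((Kz z x, z *\<^sub>C Kz z x), (x, y + F z x)) \<in> \<Gamma>t"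
      by (simp add: e1 e2 e3 add.assoc)
  next
    assume a: "((Kz z x, z *\<^sub>C Kz z x), (x, y + F z x)) \<in> \<Gamma>t"
    have "Ks (- b' + \<i> *\<^sub>C - b) = - Ks (b' + \<i> *\<^sub>C b)"
      using bclin_diff[OF Ks, of 0 "b' + \<i> *\<^sub>C b"] by (simp add: bclin_zero[OF Ks])
    then have "y + F z x + Ks (- b' + \<i> *\<^sub>C - b) = y + \<i> *\<^sub>C Ks (K x)" by (simp add: e3)
    moreover have "Kz z x + - b = K x" unfolding e1[symmetric] by simp
    moreover have "z *\<^sub>C Kz z x + - b' = \<i> *\<^sub>C K x" unfolding e2[symmetric] by simp
    ultimately show "(x, y) \<in> E"
      using Gammat_add_B[OF a b_neg] by (simp only: E_iff)
  qed
qed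

lemma weyl_Gammat:
  assumes z: "Im z \<noteq> 0" shows "weyl \<Gamma>t z = op_plus E (F z)"
proof (intro equalityI subrelI)
  fix x x' assume "(x, x') \<in> weyl \<Gamma>t z"
  then have "((Kz z x, z *\<^sub>C Kz z x), (x, (x' - F z x) + F z x)) \<in> \<Gamma>t"
    by (simp add: weyl_Gammat_iff[OF z])
  then have "(x, x' - F z x) \<in> E" unfolding Gammat_shift[OF z] .
  then show "(x, x') \<in> op_plus E (F z)"
    unfolding op_plus_def by (intro CollectI exI[of _ x] exI[of _ "x' - F z x"]) simp
next
  fix x x' assume "(x, x') \<in> op_plus E (F z)"
  then show "(x, x') \<in> weyl \<Gamma>t z"
    using Gammat_shift[OF z] by (auto simp: op_plus_def weyl_Gammat_iff[OF z])
qed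

lemma dense_dom_E: "closure (rdom E) = UNIV"
proof (rule closure_mono_UNIV[OF core_dense], rule subsetI)
  fix x assume "x \<in> {x. \<exists>x'. ((K x, \<i> *\<^sub>C K x), (x, x')) \<in> \<Gamma>G}"
  then obtain x' where "((K x, \<i> *\<^sub>C K x), (x, x')) \<in> \<Gamma>t" using GammaG_subset by blast
  then have "(x, x' - \<i> *\<^sub>C Ks (K x)) \<in> E" by (simp add: E_iff)
  then show "x \<in> rdom E" unfolding rdom_def by force
qed

lemma csub_E: "csub E"
  unfolding E_def by (rule csub_vimage[OF bclin_E_map csub_Gammat])

lemma cdd_sym_op_E: "cdd_sym_op E"
  unfolding cdd_sym_op_def
proof (intro conjI)
  have "(0, y) \<in> E \<longleftrightarrow> y = 0" for y
    using Gammat_mul[of y] csub_0[OF csub_Gammat]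
    by (auto simp: E_iff bclin_zero[OF K] bclin_zero[OF Ks] zero_prod_def)
  then show "roperator E" by (auto simp: roperator_def clin_rel_iff_csub csub_E rmul_def)
  show "closed E" unfolding E_def by (rule closed_bclin_vimage[OF bclin_E_map closed_Gammat])
  show "closure (rdom E) = UNIV" by (rule dense_dom_E)
  show "rsymmetric E" unfolding rsymmetric_def clin_rel_iff_csub
  proof (intro conjI csub_E subrelI)
    fix u v assume uv: "(u, v) \<in> E"
    \<comment> \<open>In Green's identity at \<open>\<i>\<close> both sides contain
      \<open>2 \<i> cinner (K x) (K u)\<close>, on the right from the terms
      \<open>\<i> Ks K\<close>; what remains is the symmetry of \<open>E\<close>.\<close>
    have "cinner y u = cinner x v" if "(x, y) \<in> E" for x y
      using Gammat_green[OF that[unfolded E_iff] uv[unfolded E_iff]]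
      by (simp add: cinner_algebra Ks_K K_Ks[symmetric])
    then show "(u, v) \<in> radj E" by (simp add: radj_iff)
  qed
qed

section \<open>The Nevanlinna property of \<open>F\<close>\<close>

lemma bclin_F: "Im z \<noteq> 0 \<Longrightarrow> bclin (F z)"
  unfolding F_def by (rule bclin_comp[OF Ks bclin_plus[OF bclin_scale[OF K] bclin_scale[OF bclin_comp[OF bclin_R K]]]])

lemma F_adj:
  assumes "Im z \<noteq> 0" shows "cinner (F z x) y = cinner x (F (cnj z) y)"
  unfolding F_def by (simp add: cinner_algebra Ks_K K_Ks[symmetric] R_adj[OF assms])

text \<open>The adjoint of \<open>Kz (cnj z)\<close>, as \<open>Kzs_adj\<close> confirms.\<close>

definition Kzs :: "complex \<Rightarrow> 'a \<Rightarrow> 'b" where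
  "Kzs z y = Ks (y + (z + \<i>) *\<^sub>C R z y)"

lemma bclin_Kzs: "Im z \<noteq> 0 \<Longrightarrow> bclin (Kzs z)"
  unfolding Kzs_def by (rule bclin_comp[OF Ks bclin_plus[OF bclin_id bclin_scale[OF bclin_R]]])

lemma Kzs_adj:
  assumes "Im z \<noteq> 0" shows "cinner (Kzs z y) x = cinner y (Kz (cnj z) x)"
  unfolding Kzs_def Kz_def using R_adj[OF assms] by (simp add: cinner_algebra Ks_K)

text \<open>The usual link between Weyl function and gamma-field, obtained from the resolvent
  identity: replacing the product of resolvents by their difference collapses the coefficients to
  \<open>w^2 + 1\<close> and \<open>- (z^2 + 1)\<close>. Both the sign of the imaginary part and
  holomorphy follow from it.\<close>

lemma F_diff:
  assumes z: "Im z \<noteq> 0" and w: "Im w \<noteq> 0"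
  shows "F w x - F z x = (w - z) *\<^sub>C Kzs z (Kz w x)"
proof -
  define k where "k = K x"
  have R: "R z (k + (w - \<i>) *\<^sub>C R w k) = R z k + (w - \<i>) *\<^sub>C R z (R w k)"
    by (simp add: bclin_add[OF bclin_R[OF z]] bclin_scaleC[OF bclin_R[OF z]])
  have "(w - z) *\<^sub>C (k + (w - \<i>) *\<^sub>C R w k + (z + \<i>) *\<^sub>C (R z k + (w - \<i>) *\<^sub>C R z (R w k)))
      = (w - z) *\<^sub>C k + ((w - z) * (w - \<i>)) *\<^sub>C R w k + ((w - z) * (z + \<i>)) *\<^sub>C R z k
        + ((z + \<i>) * (w - \<i>)) *\<^sub>C ((w - z) *\<^sub>C R z (R w k))"
    by (simp add: scaleC_add_right scaleC_scaleC algebra_simps)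
  also have "\<dots> = (w - z) *\<^sub>C k + ((w - z) * (w - \<i>) + (z + \<i>) * (w - \<i>)) *\<^sub>C R w k
      + ((w - z) * (z + \<i>) - (z + \<i>) * (w - \<i>)) *\<^sub>C R z k"
    unfolding resolvent_identity[OF z w] unfolding scaleC_add_left scaleC_diff_left scaleC_diff_right by simp
  also have "(w - z) * (w - \<i>) + (z + \<i>) * (w - \<i>) = w\<^sup>2 + 1"
    by (simp add: algebra_simps power2_eq_square)
  also have "(w - z) * (z + \<i>) - (z + \<i>) * (w - \<i>) = - (z\<^sup>2 + 1)"
    by (simp add: algebra_simps power2_eq_square)
  also have "(w - z) *\<^sub>C k + (w\<^sup>2 + 1) *\<^sub>C R w k + (- (z\<^sup>2 + 1)) *\<^sub>C R z k
      = (w *\<^sub>C k + (w\<^sup>2 + 1) *\<^sub>C R w k) - (z *\<^sub>C k + (z\<^sup>2 + 1) *\<^sub>C R z k)"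
    unfolding scaleC_minus_left scaleC_diff_left by simp
  finally show ?thesis
    unfolding F_def Kzs_def Kz_def k_def[symmetric] R
    by (simp only: bclin_diff[OF Ks, symmetric] bclin_scaleC[OF Ks, symmetric])
qed

text \<open>The difference formula between \<open>z\<close> and \<open>cnj z\<close>, where the two
  gamma-field factors become adjoint to each other.\<close>

lemma Im_F:
  assumes z: "Im z \<noteq> 0"
  shows "Im (cinner (F z x) x) = Im z * (norm (Kz z x))\<^sup>2"
proof -
  have z': "Im (cnj z) \<noteq> 0" using z by simp
  have "cinner (F z x - F (cnj z) x) x = (z - cnj z) * cinner (Kz z x) (Kz z x)"
    unfolding F_diff[OF z' z] by (simp add: cinner_algebra Kzs_adj[OF z'])
  moreover have "cinner (F (cnj z) x) x = cnj (cinner (F z x) x)"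
    unfolding F_adj[OF z] by (simp add: cinner_commute[of "F (cnj z) x"])
  ultimately have "cinner (F z x) x - cnj (cinner (F z x) x) = (z - cnj z) * (norm (Kz z x))\<^sup>2"
    by (simp add: cinner_diff_left cinner_self)
  then have "Im (cinner (F z x) x - cnj (cinner (F z x) x)) = Im ((z - cnj z) * (norm (Kz z x))\<^sup>2)"
    by (rule arg_cong)
  then show ?thesis by (simp add: Im_power2)
qed

text \<open>The derivative is \<open>Kzs z (Kz z x)\<close>. By \<open>Kz_shift\<close> the
  remainder is exactly \<open>(w - z)^2 Kzs z (R w (Kz z x))\<close>, and the resolvent bound
  \<open>1 / |Im w|\<close> keeps the last factor under control near \<open>z\<close>.\<close>

lemma F_holomorphic: "op_holomorphic F {z. Im z \<noteq> 0}"
  unfolding op_holomorphic_def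
proof (intro ballI)
  fix z assume "z \<in> {z. Im z \<noteq> 0}"
  then have z: "Im z \<noteq> 0" by simp
  define D where "D x = Kzs z (Kz z x)" for x
  have D: "bclin D" unfolding D_def by (rule bclin_comp[OF bclin_Kzs[OF z] bclin_Kz[OF z]])
  obtain C1 where C1: "\<And>y. norm (Kzs z y) \<le> norm y * C1" "C1 \<ge> 0"
    using bounded_linear.nonneg_bounded[OF bclin_bounded[OF bclin_Kzs[OF z]]] by blast
  obtain C2 where C2: "\<And>y. norm (Kz z y) \<le> norm y * C2" "C2 \<ge> 0"
    using bounded_linear.nonneg_bounded[OF bclin_bounded[OF bclin_Kz[OF z]]] by blast
  define q where "q w = onorm (\<lambda>x. F w x - F z x - (w - z) *\<^sub>C D x) / cmod (w - z)" for w
  define p where "p w = cmod (w - z) * (C2 * (1 / \<bar>Im w\<bar>) * C1)" for w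
  have bound: "norm (q w) \<le> p w" if w: "Im w \<noteq> 0" "w \<noteq> z" for w
  proof -
    have eq: "F w x - F z x - (w - z) *\<^sub>C D x = ((w - z) * (w - z)) *\<^sub>C Kzs z (R w (Kz z x))" for x
    proof -
      have "F w x - F z x - (w - z) *\<^sub>C D x = (w - z) *\<^sub>C Kzs z (Kz w x - Kz z x)"
        by (simp add: F_diff[OF z w(1)] D_def bclin_diff[OF bclin_Kzs[OF z]] scaleC_diff_right)
      also have "Kz w x - Kz z x = (w - z) *\<^sub>C R w (Kz z x)" using Kz_shift[OF z w(1), of x] by simp
      finally show ?thesis by (simp add: bclin_scaleC[OF bclin_Kzs[OF z]] scaleC_scaleC)
    qed
    have bl: "bounded_linear (\<lambda>x. F w x - F z x - (w - z) *\<^sub>C D x)"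
      by (rule bclin_bounded[OF bclin_minus[OF bclin_minus[OF bclin_F[OF w(1)] bclin_F[OF z]] bclin_scale[OF D]]])
    have "onorm (\<lambda>x. F w x - F z x - (w - z) *\<^sub>C D x) \<le> cmod (w - z) * p w"
    proof (rule onorm_bound)
      show "0 \<le> cmod (w - z) * p w" by (simp add: p_def C1(2) C2(2))
      fix x
      have "norm (Kzs z (R w (Kz z x))) \<le> norm x * C2 * (1 / \<bar>Im w\<bar>) * C1"
      proof -
        have "norm (R w (Kz z x)) \<le> norm x * C2 * (1 / \<bar>Im w\<bar>)"
          using norm_R_le[OF w(1), of "Kz z x"] mult_right_mono[OF C2(1)[of x], of "1 / \<bar>Im w\<bar>"] by simp
        from mult_right_mono[OF this C1(2)] show ?thesis using C1(1)[of "R w (Kz z x)"] by simp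
      qed
      then have "cmod ((w - z) * (w - z)) * norm (Kzs z (R w (Kz z x)))
          \<le> cmod ((w - z) * (w - z)) * (norm x * C2 * (1 / \<bar>Im w\<bar>) * C1)"
        by (rule mult_left_mono) simp
      then show "norm (F w x - F z x - (w - z) *\<^sub>C D x) \<le> cmod (w - z) * p w * norm x"
        unfolding eq norm_scaleC p_def by (simp add: norm_mult mult_ac)
    qed
    moreover have "0 \<le> onorm (\<lambda>x. F w x - F z x - (w - z) *\<^sub>C D x)" by (rule onorm_pos_le[OF bl])
    moreover have "cmod (w - z) > 0" using w(2) by simp
    ultimately show ?thesis by (simp add: q_def divide_le_eq mult.commute)
  qed
  have "(p \<longlongrightarrow> cmod (z - z) * (C2 * (1 / \<bar>Im z\<bar>) * C1)) (at z)"
    unfolding p_def using z by (intro tendsto_intros) auto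
  then have p0: "(p \<longlongrightarrow> 0) (at z)" by simp
  have "\<forall>\<^sub>F w in at z. Im w \<noteq> 0"
    by (rule tendsto_imp_eventually_ne[OF tendsto_Im[OF tendsto_ident_at] z])
  moreover have "\<forall>\<^sub>F w in at z. w \<noteq> z" by (simp add: eventually_at_filter)
  ultimately have "\<forall>\<^sub>F w in at z. norm (q w) \<le> p w" by eventually_elim (rule bound)
  then have "(q \<longlongrightarrow> 0) (at z)" by (rule Lim_null_comparison) (rule p0)
  then show "\<exists>D. bclin D \<and>
     ((\<lambda>w. onorm (\<lambda>x. F w x - F z x - (w - z) *\<^sub>C D x) / cmod (w - z)) \<longlongrightarrow> 0) (at z)"
    using D unfolding q_def by blast
qed

lemma nevanlinna_F: "nevanlinna F"
  unfolding nevanlinna_def is_adj_def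
proof (intro conjI allI impI)
  fix z x assume "0 < Im z"
  then show "0 \<le> Im (cinner (F z x) x)" by (simp add: Im_F)
qed (rule bclin_F F_holomorphic F_adj, assumption?)+

lemma bounded_on_F:
  assumes z: "Im z \<noteq> 0" shows "bounded_on (rdom E) (F z)"
proof -
  obtain C where "\<And>x. norm (F z x) \<le> norm x * C"
    using bounded_linear.bounded[OF bclin_bounded[OF bclin_F[OF z]]] by blast
  then show ?thesis
    unfolding bounded_on_def
    by (auto simp: bclin_add[OF bclin_F[OF z]] bclin_scaleC[OF bclin_F[OF z]] mult.commute)
qed

lemma closure_graph_F:
  assumes z: "Im z \<noteq> 0" shows "closure (graph_on (rdom E) (F z)) = range (\<lambda>x. (x, F z x))"
proof
  have "range (\<lambda>x. (x, F z x)) = (\<lambda>p. snd p - F z (fst p)) -` {0}" by (auto simp: image_iff)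
  moreover have "closed ((\<lambda>p. snd p - F z (fst p)) -` {0})"
    by (rule closed_bclin_vimage[OF bclin_minus[OF bclin_snd bclin_comp[OF bclin_F[OF z] bclin_fst]]]) simp
  ultimately have "closed (range (\<lambda>x. (x, F z x)))" by simp
  then show "closure (graph_on (rdom E) (F z)) \<subseteq> range (\<lambda>x. (x, F z x))"
    by (intro closure_minimal) (auto simp: graph_on_def)
  show "range (\<lambda>x. (x, F z x)) \<subseteq> closure (graph_on (rdom E) (F z))"
  proof (rule image_subsetI)
    fix x
    have "x \<in> closure (rdom E)" by (simp add: dense_dom_E)
    then show "(x, F z x) \<in> closure (graph_on (rdom E) (F z))"
      by (rule closure_bclin_subset[OF bclin_Pair[OF bclin_id bclin_F[OF z]], rotated])
        (auto simp: graph_on_def)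
  qed
qed

section \<open>The closure of \<open>G M(z) G\<close>\<close>

lemma K_le_Kz:
  assumes z: "Im z \<noteq> 0"
  shows "norm (K x) \<le> (1 + cmod (\<i> - z)) * norm (Kz z x)"
proof -
  have "K x = Kz z x + (\<i> - z) *\<^sub>C R \<i> (Kz z x)" using Kz_shift[OF z, of \<i> x] by (simp add: Kz_i)
  then have "norm (K x) \<le> norm (Kz z x) + cmod (\<i> - z) * norm (R \<i> (Kz z x))"
    by (metis norm_scaleC norm_triangle_ineq)
  moreover have "norm (R \<i> (Kz z x)) \<le> norm (Kz z x)" using norm_R_le[of \<i> "Kz z x"] by simp
  then have "cmod (\<i> - z) * norm (R \<i> (Kz z x)) \<le> cmod (\<i> - z) * norm (Kz z x)"
    by (rule mult_left_mono) simp
  ultimately show ?thesis by (simp add: distrib_right)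
qed

text \<open>Green's identity gives \<open>x'\<close> the imaginary part
  \<open>Im z (norm (Kz z x))^2\<close>, and \<open>z G^2\<close> contributes
  \<open>Im z (norm (G x))^2\<close> with the same sign. Their sum dominates
  \<open>(norm x)^2\<close> up to a constant, by \<open>norm_sq_GK\<close> and
  \<open>K_le_Kz\<close>.\<close>

lemma weyl_Gammat_lower_bound:
  assumes z: "Im z \<noteq> 0" and x: "(x, x') \<in> weyl \<Gamma>t z"
  shows "\<bar>Im z\<bar> * norm x \<le> (1 + cmod (\<i> - z))\<^sup>2 * norm (x' + z *\<^sub>C G (G x))"
proof -
  define c where "c = 1 + cmod (\<i> - z)"
  define v where "v = x' + z *\<^sub>C G (G x)"
  have m: "((Kz z x, z *\<^sub>C Kz z x), (x, x')) \<in> \<Gamma>t" using x by (simp add: weyl_Gammat_iff[OF z])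
  have "(z - cnj z) * (norm (Kz z x))\<^sup>2 = cinner x' x - cnj (cinner x' x)"
    using Gammat_green[OF m m] by (simp add: cinner_algebra cinner_self cinner_commute[of x x'] algebra_simps)
  then have "Im ((z - cnj z) * (norm (Kz z x))\<^sup>2) = Im (cinner x' x - cnj (cinner x' x))" by (rule arg_cong)
  then have "Im (cinner x' x) = Im z * (norm (Kz z x))\<^sup>2" by (simp add: Im_power2)
  moreover have "Im (cinner (z *\<^sub>C G (G x)) x) = Im z * (norm (G x))\<^sup>2"
    by (simp add: cinner_scaleC_left G_adj cinner_self Im_power2 Re_power2)
  ultimately have "Im (cinner v x) = Im z * ((norm (Kz z x))\<^sup>2 + (norm (G x))\<^sup>2)"
    by (simp add: v_def cinner_add_left distrib_left)
  then have "\<bar>Im z\<bar> * ((norm (Kz z x))\<^sup>2 + (norm (G x))\<^sup>2) \<le> norm v * norm x"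
    using abs_Im_le_cmod[of "cinner v x"] cauchy_schwarz[of v x] by (simp add: abs_mult)
  moreover have "(norm x)\<^sup>2 \<le> c\<^sup>2 * ((norm (Kz z x))\<^sup>2 + (norm (G x))\<^sup>2)"
  proof -
    have "(norm (K x))\<^sup>2 \<le> (c * norm (Kz z x))\<^sup>2" using K_le_Kz[OF z, of x] by (intro power_mono) (simp_all add: c_def)
    moreover have "1 * (norm (G x))\<^sup>2 \<le> c\<^sup>2 * (norm (G x))\<^sup>2"
      by (intro mult_right_mono one_le_power) (simp_all add: c_def)
    ultimately show ?thesis by (simp add: norm_sq_GK[of x] power_mult_distrib distrib_left)
  qed
  ultimately have "\<bar>Im z\<bar> * (norm x)\<^sup>2 \<le> c\<^sup>2 * (norm v * norm x)"
    by (smt (verit, best) mult.left_commute mult_left_mono abs_ge_zero zero_le_power2)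
  then show ?thesis unfolding c_def[symmetric] v_def[symmetric]
    by (cases "norm x = 0") (auto simp: power2_eq_square mult_le_cancel_right mult.assoc[symmetric])
qed

lemma csub_weyl_Gammat: "Im z \<noteq> 0 \<Longrightarrow> csub (weyl \<Gamma>t z)"
  and closed_weyl_Gammat: "Im z \<noteq> 0 \<Longrightarrow> closed (weyl \<Gamma>t z)"
proof -
  assume z: "Im z \<noteq> 0"
  define T where "T p = ((Kz z (fst p), z *\<^sub>C Kz z (fst p)), p)" for p :: "'b \<times> 'b"
  have k: "bclin (\<lambda>p::'b \<times> 'b. Kz z (fst p))" by (rule bclin_comp[OF bclin_Kz[OF z] bclin_fst])
  have T: "bclin T" unfolding T_def by (rule bclin_Pair[OF bclin_Pair[OF k bclin_scale[OF k]] bclin_id])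
  have e: "weyl \<Gamma>t z = T -` \<Gamma>t" by (auto simp: T_def weyl_Gammat_iff[OF z])
  show "csub (weyl \<Gamma>t z)" unfolding e by (rule csub_vimage[OF T csub_Gammat])
  show "closed (weyl \<Gamma>t z)" unfolding e by (rule closed_bclin_vimage[OF T closed_Gammat])
qed

text \<open>For \<open>(x, x')\<close> in the Weyl relation of \<open>\<Gamma>t\<close>, approximate
  \<open>v = x' + z G^2 x\<close> from the dense range of \<open>G\<close>. Each approximant comes
  from a point of the sandwiched graph, and the lower bound forces these points to converge to
  \<open>(x, x')\<close>.\<close>

lemma closure_sandwich:
  assumes z: "Im z \<noteq> 0"
  shows "closure (sandwich G (weyl \<Gamma> z) G) = weyl \<Gamma>t z"
proof
  have "sandwich G (weyl \<Gamma> z) G \<subseteq> weyl \<Gamma>t z"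
  proof (rule subrelI)
    fix x x' assume "(x, x') \<in> sandwich G (weyl \<Gamma> z) G"
    then obtain y f where "x' = G y" "((f, z *\<^sub>C f), (G x, y)) \<in> \<Gamma>" by (auto simp: sandwich_def weyl_def)
    then have "((f, z *\<^sub>C f), (x, x')) \<in> \<Gamma>G" by (auto simp: GammaG_iff)
    then show "(x, x') \<in> weyl \<Gamma>t z" using GammaG_subset by (auto simp: weyl_def)
  qed
  then show "closure (sandwich G (weyl \<Gamma> z) G) \<subseteq> weyl \<Gamma>t z"
    by (intro closure_minimal closed_weyl_Gammat[OF z])
  show "weyl \<Gamma>t z \<subseteq> closure (sandwich G (weyl \<Gamma> z) G)"
  proof (rule subrelI)
    fix x x' assume x: "(x, x') \<in> weyl \<Gamma>t z"
    define v where "v = x' + z *\<^sub>C G (G x)"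
    obtain u where u: "\<forall>n. u n \<in> range G" "u \<longlonglongrightarrow> v"
      using dense_sequence[OF selfadjoint_range_dense[OF G]] by blast
    have "\<forall>n. \<exists>xn m. (xn, G m) \<in> sandwich G (weyl \<Gamma> z) G \<and> u n = G m + z *\<^sub>C G (G xn)"
    proof
      fix n
      obtain y where y: "u n = G y" using u(1) by blast
      \<comment> \<open>Solves \<open>M(z) h + z h = y\<close>; applying \<open>G\<close> and
        writing \<open>h = G xn\<close> puts \<open>u n\<close> in the form
        \<open>G M(z) G xn + z G^2 xn\<close>.\<close>
      obtain f h where f: "((f, z *\<^sub>C f), (h, y - z *\<^sub>C h)) \<in> \<Gamma>"
        using main_transform_surj[OF z, of 0 y] by auto
      obtain xn where xn: "h = G xn" using gamma_field_range[OF z f] by blast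
      have "(xn, G (y - z *\<^sub>C h)) \<in> sandwich G (weyl \<Gamma> z) G"
        using f unfolding xn sandwich_def weyl_def by blast
      moreover have "u n = G (y - z *\<^sub>C h) + z *\<^sub>C G (G xn)"
        by (simp add: y xn bclin_diff[OF G(1)] bclin_scaleC[OF G(1)])
      ultimately show "\<exists>xn m. (xn, G m) \<in> sandwich G (weyl \<Gamma> z) G \<and> u n = G m + z *\<^sub>C G (G xn)" by blast
    qed
    then obtain s m where s: "\<And>n. (s n, G (m n)) \<in> sandwich G (weyl \<Gamma> z) G"
      and us: "\<And>n. u n = G (m n) + z *\<^sub>C G (G (s n))" by metis
    have "norm (s n - x) \<le> (1 + cmod (\<i> - z))\<^sup>2 / \<bar>Im z\<bar> * norm (u n - v)" for n
    proof -
      have "(s n, G (m n)) \<in> weyl \<Gamma>t z" using s \<open>sandwich G (weyl \<Gamma> z) G \<subseteq> weyl \<Gamma>t z\<close> by blast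
      from csub_diff[OF csub_weyl_Gammat[OF z] this x]
      have "(s n - x, G (m n) - x') \<in> weyl \<Gamma>t z" by simp
      from weyl_Gammat_lower_bound[OF z this]
      have "\<bar>Im z\<bar> * norm (s n - x) \<le> (1 + cmod (\<i> - z))\<^sup>2 * norm (G (m n) - x' + z *\<^sub>C G (G (s n - x)))" .
      also have "G (m n) - x' + z *\<^sub>C G (G (s n - x)) = u n - v"
        by (simp add: us v_def bclin_diff[OF G(1)] scaleC_diff_right)
      finally show ?thesis using z by (simp add: field_simps)
    qed
    moreover have "(\<lambda>n. (1 + cmod (\<i> - z))\<^sup>2 / \<bar>Im z\<bar> * norm (u n - v)) \<longlonglongrightarrow> (1 + cmod (\<i> - z))\<^sup>2 / \<bar>Im z\<bar> * norm (v - v)"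
      by (intro tendsto_intros u)
    ultimately have "(\<lambda>n. s n - x) \<longlonglongrightarrow> 0" by (intro Lim_null_comparison[of "\<lambda>n. s n - x"]) auto
    then have sx: "s \<longlonglongrightarrow> x" by (rule LIM_zero_cancel)
    have "(\<lambda>n. u n - z *\<^sub>C G (G (s n))) \<longlonglongrightarrow> v - z *\<^sub>C G (G x)"
      by (intro tendsto_diff tendsto_scaleC tendsto_const u bclin_tendsto[OF G(1)] sx)
    then have "(\<lambda>n. G (m n)) \<longlonglongrightarrow> x'" by (simp add: us v_def)
    with sx have "(\<lambda>n. (s n, G (m n))) \<longlonglongrightarrow> (x, x')" by (rule tendsto_Pair)
    then show "(x, x') \<in> closure (sandwich G (weyl \<Gamma> z) G)"
      unfolding closure_sequential using s by (intro exI[of _ "\<lambda>n. (s n, G (m n))"]) simp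
  qed
qed

end

section \<open>Assembly of the three assertions\<close>

theorem mainTheorem10:
  fixes A :: "('a::chilbert \<times> 'a) set"
    and \<Gamma> :: "(('a \<times> 'a) \<times> ('b::chilbert \<times> 'b)) set"
  assumes A_closed_sym: "rsymmetric A" "closed A"
    and ubt: "unitary_bt A \<Gamma>"
    and A0_ess_sa: "rselfadjoint (closure (rker (Gamma0 \<Gamma>)))"
  shows "\<exists>G Gs. bclin G \<and> is_adj G Gs \<and> {x. G x = 0} = {0}
      \<and> (\<forall>z. Im z \<noteq> 0 \<longrightarrow> range G = rdom (closure (gamma_field \<Gamma> z)))
      \<and> AB_pair A (closure (transformed \<Gamma> G Gs))
      \<and> (\<exists>E M0. cdd_sym_op E
          \<and> domain_invariant (weyl (closure (transformed \<Gamma> G Gs)))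
          \<and> (\<forall>z. Im z \<noteq> 0 \<longrightarrow> weyl (closure (transformed \<Gamma> G Gs)) z = op_plus E (M0 z))
          \<and> (\<forall>z. Im z \<noteq> 0 \<longrightarrow> bounded_on (rdom E) (M0 z))
          \<and> (\<exists>F. nevanlinna F \<and>
               (\<forall>z. Im z \<noteq> 0 \<longrightarrow> closure (graph_on (rdom E) (M0 z)) = range (\<lambda>x. (x, F z x))))
          \<and> (\<exists>\<Gamma>'. closed \<Gamma>' \<and> AB_pair A \<Gamma>' \<and>
               (\<forall>z. Im z \<noteq> 0 \<longrightarrow> weyl \<Gamma>' z = closure (sandwich Gs (weyl \<Gamma> z) G)))
          \<and> (\<exists>E0. E0 \<subseteq> E \<and> cdd_sym_op E0 \<and>
               (\<forall>z. Im z \<noteq> 0 \<longrightarrow>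
                  closure (sandwich Gs (weyl \<Gamma> z) G) = op_plus E0 (M0 z)
                \<and> op_plus E0 (M0 z) \<subseteq> weyl (closure (transformed \<Gamma> G Gs)) z)))"
proof -
  interpret ess_unitary_triple A \<Gamma> using ubt A0_ess_sa by unfold_locales
  obtain G K where G: "bclin G" and K: "bclin K" and G_adj: "is_adj G G"
    and inj: "\<forall>x. G x = 0 \<longrightarrow> x = 0"
    and factor: "closure (gamma_field \<Gamma> \<i>) = range (\<lambda>x. (G x, K x))"
    and iso: "\<forall>x. norm (G x, K x) = norm x"
    using gamma_factorization by (elim exE conjE) (rule that; assumption)
  obtain Ks where Ks: "bclin Ks" "is_adj K Ks" using adjoint_exists[OF K] by (elim exE conjE) (rule that; assumption)
  interpret factorized_triple A \<Gamma> G K Ks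
    by unfold_locales (fact G G_adj K Ks factor | erule inj[rule_format] | rule iso[rule_format])+
  have \<Gamma>t: "closure (transformed \<Gamma> G G) = \<Gamma>t" by (simp add: \<Gamma>t_def \<Gamma>G_def)
  have "rdom (op_plus E (F z)) = rdom E" for z
    unfolding rdom_def op_plus_def by force
  then have inv: "domain_invariant (weyl \<Gamma>t)" by (simp add: domain_invariant_def weyl_Gammat)
  have ker: "{x. G x = 0} = {0}" using inj bclin_zero[OF G(1)] by blast
  show ?thesis
  \<comment> \<open>Both operators are \<open>G\<close>, which is its own adjoint.\<close>
  proof (intro exI[of _ G] conjI)
    show "\<forall>z. Im z \<noteq> 0 \<longrightarrow> range G = rdom (closure (gamma_field \<Gamma> z))" by (simp add: dom_closure_gamma)
    show "AB_pair A (closure (transformed \<Gamma> G G))" unfolding \<Gamma>t by (rule AB_Gammat)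
    show "\<exists>E M0. cdd_sym_op E
          \<and> domain_invariant (weyl (closure (transformed \<Gamma> G G)))
          \<and> (\<forall>z. Im z \<noteq> 0 \<longrightarrow> weyl (closure (transformed \<Gamma> G G)) z = op_plus E (M0 z))
          \<and> (\<forall>z. Im z \<noteq> 0 \<longrightarrow> bounded_on (rdom E) (M0 z))
          \<and> (\<exists>F. nevanlinna F \<and>
               (\<forall>z. Im z \<noteq> 0 \<longrightarrow> closure (graph_on (rdom E) (M0 z)) = range (\<lambda>x. (x, F z x))))
          \<and> (\<exists>\<Gamma>'. closed \<Gamma>' \<and> AB_pair A \<Gamma>' \<and>
               (\<forall>z. Im z \<noteq> 0 \<longrightarrow> weyl \<Gamma>' z = closure (sandwich G (weyl \<Gamma> z) G)))
          \<and> (\<exists>E0. E0 \<subseteq> E \<and> cdd_sym_op E0 \<and>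
               (\<forall>z. Im z \<noteq> 0 \<longrightarrow>
                  closure (sandwich G (weyl \<Gamma> z) G) = op_plus E0 (M0 z)
                \<and> op_plus E0 (M0 z) \<subseteq> weyl (closure (transformed \<Gamma> G G)) z))"
      unfolding \<Gamma>t
      \<comment> \<open>\<open>E\<close> is the witness for \<open>E\<close> and for
        \<open>E0\<close>. \<open>F\<close> serves both as \<open>M0\<close> and as the Nevanlinna
        extension, being defined on all of the space already. The closed pair in the third assertion
        is \<open>\<Gamma>t\<close> itself.\<close>
      by (intro exI[of _ E] exI[of _ F] exI[of _ \<Gamma>t] conjI)
        (simp_all add: cdd_sym_op_E inv weyl_Gammat bounded_on_F nevanlinna_F closure_graph_F
          closed_Gammat AB_Gammat closure_sandwich)
  qed (fact G(1) G(2) ker)+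
qed

end
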